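(* Let $\Omega\subset\mathbb{R}^2$ be a non-empty, bounded, open, convex set with width $w(\Omega)$ and diameter $\mathrm{diam}(\Omega)$. Then $$\|v_{\Omega}\|_{L^{\infty}(\Omega)}\,\lambda(\Omega)\le \frac{\pi^2}{8}\left(1+7\cdot3^{2/3}\left(\frac{w(\Omega)}{\mathrm{diam}(\Omega)}\right)^{2/3}\right).$$
   Context: For a non-empty bounded open set $\Omega\subset\mathbb{R}^2$, the torsion function $v_\Omega$ is the unique (weak) solution of $-\Delta v=1$ in $\Omega$, $v\in H_0^1(\Omega)$. The quantity $$\lambda(\Omega)=\inf_{\varphi\in H_0^1(\Omega)\setminus\{0\}}\frac{\int_\Omega|D\varphi|^2}{\int_\Omega\varphi^2}$$ is the bottom of the spectrum of the Dirichlet Laplacian acting in $L^2(\Omega)$. The width $w(\Omega)$ is the minimal distance between two parallel lines supporting $\Omega$ (so that $\Omega$ lies between them), and $\mathrm{diam}(\Omega)=\sup\{|x-y|:x\in\Omega,\,y\in\Omega\}$. *)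

theory Defs
  imports "HOL-Analysis.Analysis" "HOL-Probability.Essential_Supremum"
begin

definition grad :: "('a::euclidean_space \<Rightarrow> real) \<Rightarrow> 'a \<Rightarrow> 'a" where
  "grad f x = (\<Sum>b\<in>Basis. frechet_derivative f (at x) b *\<^sub>R b)"

primrec Ck :: "nat \<Rightarrow> ('a::euclidean_space \<Rightarrow> real) \<Rightarrow> bool" where
  "Ck 0 f \<longleftrightarrow> continuous_on UNIV f"
| "Ck (Suc k) f \<longleftrightarrow>
     (\<forall>x. f differentiable (at x)) \<and> (\<forall>b\<in>Basis. Ck k (\<lambda>x. frechet_derivative f (at x) b))"

definition test_functions :: "'a::euclidean_space set \<Rightarrow> ('a \<Rightarrow> real) set" where
  "test_functions \<Omega> =
     {\<phi>. (\<forall>k. Ck k \<phi>) \<and> compact (closure {x. \<phi> x \<noteq> 0}) \<and> closure {x. \<phi> x \<noteq> 0} \<subseteq> \<Omega>}"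

text \<open>
  Functions on \<open>\<Omega>\<close> are represented by total functions whose values outside \<open>\<Omega>\<close> are irrelevant,
  and they are not identified when they agree almost everywhere.  The weak gradient is only
  determined up to null sets, so it is carried along as a second argument:
  \<open>has_weak_grad \<Omega> u g\<close> says that \<open>u\<close> belongs to \<open>H\<^sup>1(\<Omega>)\<close> and \<open>Du = g\<close>, and
  \<open>H01_grad \<Omega> u g\<close> says that \<open>u\<close> belongs to \<open>H\<^sub>0\<^sup>1(\<Omega>)\<close>, the closure of the test functions
  in \<open>H\<^sup>1(\<Omega>)\<close>, and \<open>Du = g\<close>.
\<close>

definition square_integrable ::
    "'a::euclidean_space set \<Rightarrow> ('a \<Rightarrow> 'b::euclidean_space) \<Rightarrow> bool" where
  "square_integrable \<Omega> f \<longleftrightarrow>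
     f \<in> borel_measurable (lebesgue_on \<Omega>) \<and> integrable (lebesgue_on \<Omega>) (\<lambda>x. (norm (f x))\<^sup>2)"

definition has_weak_grad ::
    "'a::euclidean_space set \<Rightarrow> ('a \<Rightarrow> real) \<Rightarrow> ('a \<Rightarrow> 'a) \<Rightarrow> bool" where
  "has_weak_grad \<Omega> u g \<longleftrightarrow>
     square_integrable \<Omega> u \<and> square_integrable \<Omega> g \<and>
     (\<forall>\<phi>\<in>test_functions \<Omega>. \<forall>b\<in>Basis.
        (\<integral>x. u x * frechet_derivative \<phi> (at x) b \<partial>lebesgue_on \<Omega>)
          = - (\<integral>x. (g x \<bullet> b) * \<phi> x \<partial>lebesgue_on \<Omega>))"

definition H01_grad ::
    "'a::euclidean_space set \<Rightarrow> ('a \<Rightarrow> real) \<Rightarrow> ('a \<Rightarrow> 'a) \<Rightarrow> bool" where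
  "H01_grad \<Omega> u g \<longleftrightarrow>
     has_weak_grad \<Omega> u g \<and>
     (\<exists>\<phi>. (\<forall>n::nat. \<phi> n \<in> test_functions \<Omega>) \<and>
          (\<lambda>n. (\<integral>x. (\<phi> n x - u x)\<^sup>2 \<partial>lebesgue_on \<Omega>)
             + (\<integral>x. (norm (grad (\<phi> n) x - g x))\<^sup>2 \<partial>lebesgue_on \<Omega>)) \<longlonglongrightarrow> 0)"

text \<open>
  Weak solutions of \<open>-\<Delta>v = 1\<close> in \<open>H\<^sub>0\<^sup>1(\<Omega>)\<close>; for bounded open \<open>\<Omega>\<close> the solution exists and is
  unique up to null sets.
\<close>

definition is_torsion_function :: "'a::euclidean_space set \<Rightarrow> ('a \<Rightarrow> real) \<Rightarrow> bool" where
  "is_torsion_function \<Omega> v \<longleftrightarrow>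
     (\<exists>g. H01_grad \<Omega> v g \<and>
          (\<forall>\<phi>\<in>test_functions \<Omega>.
             (\<integral>x. g x \<bullet> grad \<phi> x \<partial>lebesgue_on \<Omega>) = (\<integral>x. \<phi> x \<partial>lebesgue_on \<Omega>)))"

definition dirichlet_bottom :: "'a::euclidean_space set \<Rightarrow> real" where
  "dirichlet_bottom \<Omega> =
     Inf {(\<integral>x. (norm (g x))\<^sup>2 \<partial>lebesgue_on \<Omega>) / (\<integral>x. (\<phi> x)\<^sup>2 \<partial>lebesgue_on \<Omega>) | \<phi> g.
            H01_grad \<Omega> \<phi> g \<and> \<not> (AE x in lebesgue_on \<Omega>. \<phi> x = 0)}"

definition Linf_norm :: "'a::euclidean_space set \<Rightarrow> ('a \<Rightarrow> real) \<Rightarrow> ereal" where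
  "Linf_norm \<Omega> f = esssup (lebesgue_on \<Omega>) (\<lambda>x. ereal \<bar>f x\<bar>)"

text \<open>
  The parallel lines are \<open>{x. e \<bullet> x = a}\<close> and \<open>{x. e \<bullet> x = b}\<close>.  An open set does not meet its
  supporting lines, so these are required to touch the closure.
\<close>

definition width :: "(real^2) set \<Rightarrow> real" where
  "width \<Omega> =
     Inf {setdist {x. e \<bullet> x = a} {x. e \<bullet> x = b} | e a b.
            norm e = 1 \<and> (\<forall>x\<in>\<Omega>. a \<le> e \<bullet> x \<and> e \<bullet> x \<le> b) \<and>
            {x. e \<bullet> x = a} \<inter> closure \<Omega> \<noteq> {} \<and> {x. e \<bullet> x = b} \<inter> closure \<Omega> \<noteq> {}}"

end

theory Submission
  imports Defs
begin

text \<open>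
  If \<open>\<Omega>\<close> lies in a strip \<open>a \<le> e \<bullet> x \<le> b\<close>, then by the weak maximum principle
  \<open>\<bar>v\<bar> \<le> (e \<bullet> x - a) (b - e \<bullet> x) / 2 \<le> (b - a)\<^sup>2 / 8\<close>, so \<open>\<parallel>v\<parallel> \<le> w\<^sup>2 / 8\<close>.  On the other
  hand, in every direction \<open>\<Omega>\<close> contains chords of any length \<open>t < w\<close>.  Take such a chord \<open>C\<close>
  orthogonal to a diameter \<open>D\<close> of \<open>closure \<Omega>\<close>, of length \<open>d\<close>.  By convexity the Minkowski
  combination \<open>(1 - s) C + s D\<close>, a rectangle with sides \<open>(1 - s) t\<close> and \<open>s d\<close>, lies in \<open>\<Omega>\<close>, whence
  \<open>\<lambda> \<le> \<pi>\<^sup>2 / (s d)\<^sup>2 + \<pi>\<^sup>2 / ((1 - s) w)\<^sup>2\<close>.  With \<open>q = (w / d) powr (2 / 3)\<close> and \<open>s = q / 2\<close> the product of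
  the two bounds is at most \<open>\<pi>\<^sup>2 / 8 (1 + 7 q)\<close>.
\<close>

section \<open>Smooth functions\<close>

text \<open>Membership in \<open>H01_grad\<close> and the torsion equation are both expressed
  through test functions, so every comparison function must be smooth with compact support. The two
  natural candidates are not: the positive part of \<open>v\<close> minus the barrier has a kink,
  and so has the first eigenfunction of a rectangle extended by zero. One device repairs both, a
  smooth substitute \<open>soft_pos\<close> for the positive part that vanishes for nonpositive
  arguments and has slope \<open>c\<close> in [0, 1]. Since \<open>c * c \<le> c\<close>, the energy
  identity for the positive part survives as an inequality in the useful direction. As only
  compactly supported products are integrated by parts, no regularity of the boundary of \<Omega>
  enters.

  The exponent 2/3 comes from a balance. The product of the two bounds is \<pi>^2 / 8 times (w /
  d)^2 / s^2 + 1 / (1 - s)^2. For small s the second term exceeds 1 by about 2 s, so the two errors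
  are of the same order when s^3 is comparable to (w / d)^2, that is, when s is a multiple of q.
  With s = q / 2 the first term is exactly 4 q.\<close>

lemma GDERIV_frechet:
  assumes "GDERIV f x :> D"
  shows "f differentiable at x" "frechet_derivative f (at x) h = h \<bullet> D" "grad f x = D"
proof -
  have d: "(f has_derivative (\<lambda>h. h \<bullet> D)) (at x)"
    using assms by (simp add: gderiv_def)
  then show "f differentiable at x"
    by (auto simp: differentiable_def)
  have fr: "frechet_derivative f (at x) = (\<lambda>h. h \<bullet> D)"
    using frechet_derivative_at[OF d] by simp
  then show "frechet_derivative f (at x) h = h \<bullet> D"
    by simp
  show "grad f x = D"
    unfolding grad_def fr by (simp add: inner_commute[of _ D] euclidean_representation)
qed

lemma GDERIV_grad:
  assumes "f differentiable at x"
  shows "GDERIV f x :> grad f x"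
proof -
  have d: "(f has_derivative frechet_derivative f (at x)) (at x)"
    using assms frechet_derivative_works by blast
  then have "linear (frechet_derivative f (at x))"
    by (rule has_derivative_linear)
  then have "frechet_derivative f (at x) h = h \<bullet> grad f x" for h
    unfolding grad_def using linear_sum[of "frechet_derivative f (at x)" "\<lambda>b. (h \<bullet> b) *\<^sub>R b" Basis]
    by (simp add: euclidean_representation linear_scale inner_sum_right mult.commute)
  then show ?thesis
    using d by (simp add: gderiv_def) (metis (no_types, lifting) ext)
qed

lemma Ck_imp_continuous: "Ck k f \<Longrightarrow> continuous_on UNIV f"
  by (cases k) (auto simp: continuous_on_eq_continuous_at differentiable_imp_continuous_within)

lemma Ck_SucD: "Ck (Suc k) f \<Longrightarrow> Ck k f"
proof (induction k arbitrary: f)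
  case 0
  then show ?case
    using Ck_imp_continuous by (metis Ck.simps(1))
qed auto

text \<open>Together with \<open>Ck_SucE\<close> this trades the partial derivatives in the
  recursion for the gradient, so that the sum, product and chain rules for \<open>GDERIV\<close>
  drive the inductions below.\<close>

lemma Ck_SucI:
  assumes "\<And>x. GDERIV f x :> D x" "\<And>b. b \<in> Basis \<Longrightarrow> Ck k (\<lambda>x. b \<bullet> D x)"
  shows "Ck (Suc k) f"
  using assms GDERIV_frechet(1)[OF assms(1)] by (simp add: GDERIV_frechet(2)[OF assms(1)])

lemma Ck_SucE:
  assumes "Ck (Suc k) f"
  shows "GDERIV f x :> grad f x" "b \<in> Basis \<Longrightarrow> Ck k (\<lambda>x. b \<bullet> grad f x)"
proof -
  show g: "GDERIV f x :> grad f x" for x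
    using assms GDERIV_grad by auto
  show "b \<in> Basis \<Longrightarrow> Ck k (\<lambda>x. b \<bullet> grad f x)"
    using assms by (simp add: GDERIV_frechet(2)[OF g])
qed

lemma Ck_const [simp]: "Ck k (\<lambda>_. c)"
proof (induction k arbitrary: c)
  case (Suc k)
  then show ?case
    by (intro Ck_SucI[OF GDERIV_const]) auto
qed simp

lemma Ck_inner: "Ck k (\<lambda>x. e \<bullet> x)"
proof (cases k)
  case (Suc n)
  have "GDERIV (\<lambda>x. e \<bullet> x) x :> e" for x
    unfolding gderiv_def by (auto intro!: derivative_eq_intros simp: inner_commute)
  then show ?thesis
    unfolding Suc by (rule Ck_SucI) auto
qed (auto intro!: continuous_intros)

lemma Ck_add: "Ck k f \<Longrightarrow> Ck k g \<Longrightarrow> Ck k (\<lambda>x. f x + g x)"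
proof (induction k arbitrary: f g)
  case (Suc k)
  show ?case
    by (rule Ck_SucI, rule GDERIV_add[OF Ck_SucE(1)[OF Suc.prems(1)] Ck_SucE(1)[OF Suc.prems(2)]])
      (auto simp: inner_add_right intro!: Suc.IH Ck_SucE(2) Suc.prems)
qed (auto intro!: continuous_intros)

lemma Ck_mult: "Ck k f \<Longrightarrow> Ck k g \<Longrightarrow> Ck k (\<lambda>x. f x * g x)"
proof (induction k arbitrary: f g)
  case (Suc k)
  show ?case
    by (rule Ck_SucI, rule GDERIV_mult[OF Ck_SucE(1)[OF Suc.prems(1)] Ck_SucE(1)[OF Suc.prems(2)]])
      (auto simp: inner_add_right intro!: Ck_add Suc.IH Ck_SucE(2) Suc.prems Ck_SucD[OF Suc.prems(1)] Ck_SucD[OF Suc.prems(2)])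
qed (auto intro!: continuous_intros)

lemma Ck_cmult: "Ck k f \<Longrightarrow> Ck k (\<lambda>x. c * f x)"
  by (intro Ck_mult Ck_const)

lemma Ck_diff: "Ck k f \<Longrightarrow> Ck k g \<Longrightarrow> Ck k (\<lambda>x. f x - g x)"
  using Ck_add[OF _ Ck_cmult[of k g "-1"]] by simp

lemma Ck_SucI_real:
  assumes "\<And>x. (f has_real_derivative f' x) (at x)" "Ck k f'"
  shows "Ck (Suc k) f"
  using assms by (intro Ck_SucI[of f f']) simp_all

lemma Ck_compose:
  fixes g :: "real \<Rightarrow> real"
  shows "Ck k g \<Longrightarrow> Ck k f \<Longrightarrow> Ck k (\<lambda>x. g (f x))"
proof (induction k arbitrary: g f)
  case 0
  then show ?case
    using continuous_on_compose2[of UNIV g UNIV f] by auto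
next
  case (Suc k)
  have g: "(g has_real_derivative grad g y) (at y)" for y
    using Ck_SucE(1)[OF Suc.prems(1)] by simp
  have "Ck k (grad g)"
    using Ck_SucE(2)[OF Suc.prems(1), of 1] by simp
  then have "Ck k (\<lambda>x. grad g (f x))"
    using Suc.IH Ck_SucD[OF Suc.prems(2)] by blast
  then show ?case
    by (intro Ck_SucI[OF GDERIV_DERIV_compose[OF Ck_SucE(1)[OF Suc.prems(2)] g]])
      (auto intro!: Ck_mult Ck_SucE(2) Suc.prems)
qed

text \<open>Needed to glue a smooth function to zero. Functions that agree on an open set have the
  same gradient there, so the hypothesis reproduces itself one order lower.\<close>

lemma Ck_local:
  assumes "\<And>x. \<exists>U g. open U \<and> x \<in> U \<and> Ck k g \<and> (\<forall>y\<in>U. f y = g y)"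
  shows "Ck k f"
  using assms
proof (induction k arbitrary: f)
  case 0
  have "isCont f x" for x
  proof -
    obtain U g where U: "open U" "x \<in> U" "Ck 0 g" "\<forall>y\<in>U. f y = g y"
      using 0 by blast
    then have "isCont g x"
      by (simp add: continuous_on_eq_continuous_at)
    moreover have "\<forall>\<^sub>F y in nhds x. f y = g y"
      using U eventually_nhds by blast
    ultimately show ?thesis
      using isCont_cong by blast
  qed
  then show ?case
    by (simp add: continuous_on_eq_continuous_at)
next
  case (Suc k)
  have loc: "\<exists>U g. open U \<and> x \<in> U \<and> Ck (Suc k) g \<and> (\<forall>y\<in>U. GDERIV f y :> grad g y)" for x
  proof -
    obtain U g where U: "open U" "x \<in> U" "Ck (Suc k) g" "\<forall>y\<in>U. f y = g y"
      using Suc.prems by blast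
    have "GDERIV f y :> grad g y" if "y \<in> U" for y
      using Ck_SucE(1)[OF U(3), of y] U(1,4) that
      unfolding gderiv_def by (metis has_derivative_transform_within_open)
    with U show ?thesis
      by blast
  qed
  then have "GDERIV f x :> grad f x" for x
    by (metis GDERIV_frechet(3))
  then have D: "\<And>x. GDERIV f x :> grad f x" .
  show ?case
  proof (rule Ck_SucI[OF D], rule Suc.IH)
    fix b x :: 'a
    assume b: "b \<in> Basis"
    obtain U g where U: "open U" "x \<in> U" "Ck (Suc k) g" "\<forall>y\<in>U. GDERIV f y :> grad g y"
      using loc by blast
    show "\<exists>U g. open U \<and> x \<in> U \<and> Ck k g \<and> (\<forall>y\<in>U. b \<bullet> grad f y = g y)"
      using U GDERIV_frechet(3) Ck_SucE(2)[OF U(3) b] by (metis (no_types, lifting))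
  qed
qed

lemma Ck_sin_cos: "Ck k (sin :: real \<Rightarrow> real) \<and> Ck k (cos :: real \<Rightarrow> real)"
proof (induction k)
  case (Suc k)
  have "Ck k (\<lambda>x::real. - sin x)"
    using Ck_cmult[of k sin "-1"] Suc by simp
  with Suc show ?case
    by (intro conjI Ck_SucI_real[of sin cos] Ck_SucI_real[of cos "\<lambda>x. - sin x"])
      (auto intro: derivative_eq_intros)
qed (auto intro!: continuous_intros)

section \<open>A smooth substitute for the positive part\<close>

definition flat :: "nat \<Rightarrow> real \<Rightarrow> real" where
  "flat m t = (if t > 0 then exp (- 1 / t) / t ^ m else 0)"

text \<open>The single term of degree \<open>m + 2\<close> in the series of
  \<open>exp (1 / t)\<close> already beats \<open>t ^ m\<close> with a factor
  \<open>t\<^sup>2\<close> to spare. A quadratic bound forces the derivative at 0 to vanish.\<close>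

lemma flat_le: "\<bar>flat m t\<bar> \<le> fact (m + 2) * t\<^sup>2"
proof (cases "t > 0")
  case True
  have "(1 / t) ^ (m + 2) / fact (m + 2) \<le> exp (1 / t)"
  proof -
    have "(\<Sum>n\<in>{m+2}. inverse (fact n) *\<^sub>R (1 / t) ^ n) \<le> (\<Sum>n. inverse (fact n) *\<^sub>R (1 / t) ^ n)"
      using True by (intro sum_le_suminf summable_exp_generic) auto
    then show ?thesis
      by (simp add: exp_def divide_inverse mult.commute)
  qed
  then have "1 \<le> exp (1 / t) * fact (m + 2) * t ^ (m + 2)"
    using True by (simp add: field_simps del: fact_Suc)
  then have "exp (- 1 / t) \<le> exp (- 1 / t) * (exp (1 / t) * fact (m + 2) * t ^ (m + 2))"
    by simp
  also have "\<dots> = fact (m + 2) * t\<^sup>2 * t ^ m"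
    by (simp add: exp_minus field_simps power_add power2_eq_square del: fact_Suc)
  finally show ?thesis
    using True by (simp add: flat_def field_simps del: fact_Suc)
qed (simp add: flat_def)

text \<open>This formula is the purpose of the parameter \<open>m\<close>: derivatives of members of
  the family are linear combinations of members, so smoothness follows by induction on the order
  with \<open>m\<close> arbitrary.\<close>

lemma DERIV_flat: "(flat m has_real_derivative flat (m + 2) t - real m * flat (m + 1) t) (at t)"
proof -
  consider "t > 0" | "t < 0" | "t = 0"
    by linarith
  then show ?thesis
  proof cases
    case 1
    have "((\<lambda>t. exp (- 1 / t) / t ^ m) has_real_derivative
        (exp (- 1 / t) * (1 / t\<^sup>2) * t ^ m - exp (- 1 / t) * (real m * t ^ (m - 1))) / (t ^ m * t ^ m)) (at t)"
      using 1 by (auto intro!: derivative_eq_intros simp: power2_eq_square)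
    also have "(exp (- 1 / t) * (1 / t\<^sup>2) * t ^ m - exp (- 1 / t) * (real m * t ^ (m - 1))) / (t ^ m * t ^ m)
        = flat (m + 2) t - real m * flat (m + 1) t"
      using 1 by (cases m) (auto simp: flat_def field_simps power2_eq_square power_add)
    finally show ?thesis
      by (rule has_field_derivative_transform_within_open[of _ _ _ "{0<..}"]) (use 1 in \<open>auto simp: flat_def\<close>)
  next
    case 2
    have "((\<lambda>t. 0) has_real_derivative 0) (at t)"
      by simp
    then have "(flat m has_real_derivative 0) (at t)"
      by (rule has_field_derivative_transform_within_open[of _ _ _ "{..<0}"]) (use 2 in \<open>auto simp: flat_def\<close>)
    with 2 show ?thesis
      by (simp add: flat_def)
  next
    case 3
    have "(\<lambda>h. (flat m (0 + h) - flat m 0) / h) \<midarrow>0\<rightarrow> 0"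
    proof (rule Lim_null_comparison)
      have "norm ((flat m (0 + h) - flat m 0) / h) \<le> fact (m + 2) * \<bar>h\<bar>" for h
      proof (cases "h = 0")
        case False
        then show ?thesis
          using flat_le[of m h] by (simp add: flat_def[of m 0] field_simps power2_eq_square abs_mult
            del: fact_Suc)
      qed simp
      then show "\<forall>\<^sub>F h in at 0. norm ((flat m (0 + h) - flat m 0) / h) \<le> fact (m + 2) * \<bar>h\<bar>"
        by simp
      show "(\<lambda>h::real. fact (m + 2) * \<bar>h\<bar>) \<midarrow>0\<rightarrow> 0"
        by (auto intro!: tendsto_eq_intros)
    qed
    then show ?thesis
      using 3 by (simp add: flat_def DERIV_def)
  qed
qed

lemma Ck_flat: "Ck k (flat m)"
proof (induction k arbitrary: m)
  case 0
  show ?case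
    using DERIV_flat by (auto simp: continuous_on_eq_continuous_at intro: DERIV_isCont)
next
  case (Suc k)
  show ?case
    by (rule Ck_SucI_real[OF DERIV_flat]) (intro Ck_diff Ck_cmult Suc)
qed

text \<open>The factor \<open>t\<close> keeps \<open>soft_pos t\<close> within distance 1 of \<open>max 0 t\<close> for all \<open>t\<close>.\<close>

definition soft_pos :: "real \<Rightarrow> real" where
  "soft_pos t = t * flat 0 t"

definition soft_pos' :: "real \<Rightarrow> real" where
  "soft_pos' t = flat 0 t + flat 1 t"

lemma DERIV_soft_pos: "(soft_pos has_real_derivative soft_pos' t) (at t)"
proof -
  have "(soft_pos has_real_derivative 1 * flat 0 t + (flat (0 + 2) t - real 0 * flat (0 + 1) t) * t) (at t)"
    unfolding soft_pos_def by (rule DERIV_mult'[THEN DERIV_cong, OF _ DERIV_flat]) (auto intro: derivative_eq_intros)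
  then show ?thesis
    by (rule DERIV_cong) (auto simp: soft_pos'_def flat_def power2_eq_square)
qed

lemma Ck_soft_pos: "Ck k soft_pos"
proof -
  have "Ck k (\<lambda>t::real. t)"
    using Ck_inner[of k "1::real"] by simp
  then show ?thesis
    unfolding soft_pos_def by (intro Ck_mult Ck_flat)
qed

text \<open>The upper bound is \<open>1 + x \<le> exp x\<close> at \<open>x = 1 / t\<close>. Both
  bounds together give \<open>c * c \<le> c\<close> for the slope \<open>c\<close>, on which both
  energy estimates rest.\<close>

lemma soft_pos'_bounds: "0 \<le> soft_pos' t" "soft_pos' t \<le> 1"
proof -
  show "0 \<le> soft_pos' t"
    by (simp add: soft_pos'_def flat_def)
  have "exp (- 1 / t) * (1 + 1 / t) \<le> exp (- 1 / t) * exp (1 / t)"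
    by (intro mult_left_mono exp_ge_add_one_self) auto
  also have "\<dots> = 1"
    by (simp flip: exp_add)
  finally show "soft_pos' t \<le> 1"
    by (auto simp: soft_pos'_def flat_def algebra_simps)
qed

lemma soft_pos_nonneg: "0 \<le> soft_pos t"
  by (simp add: soft_pos_def flat_def)

lemma soft_pos_eq_0_iff: "soft_pos t = 0 \<longleftrightarrow> t \<le> 0"
  by (auto simp: soft_pos_def flat_def)

text \<open>From \<open>exp (- 1 / t) \<ge> 1 - 1 / t\<close>. The loss stays below a constant for
  all \<open>t\<close>, hence becomes relatively small when the argument is scaled up.\<close>

lemma soft_pos_ge: "t - 1 \<le> soft_pos t"
proof (cases "t > 0")
  case True
  have "t * (1 + - 1 / t) \<le> t * exp (- 1 / t)"
    using True by (intro mult_left_mono exp_ge_add_one_self) auto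
  also have "t * (1 + - 1 / t) = t - 1"
    using True by (simp add: algebra_simps)
  finally show ?thesis
    using True by (simp add: soft_pos_def flat_def)
qed (simp add: soft_pos_def flat_def)

text \<open>Lets truncation pass from the approximating test functions to their limit in
  L^2.\<close>

lemma soft_pos_Lipschitz: "\<bar>soft_pos s - soft_pos t\<bar> \<le> \<bar>s - t\<bar>"
proof -
  have "norm (soft_pos s - soft_pos t) \<le> 1 * norm (s - t)"
    by (rule field_differentiable_bound[of UNIV soft_pos soft_pos'])
      (auto intro: DERIV_soft_pos simp: soft_pos'_bounds)
  then show ?thesis
    by simp
qed

section \<open>Test functions and integration by parts\<close>

text \<open>Any compact set outside which \<phi> vanishes may stand in for the support, so supports
  of products and compositions need not be computed.\<close>

lemma test_functions_iff:
  "\<phi> \<in> test_functions \<Omega> \<longleftrightarrow>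
    (\<forall>k. Ck k \<phi>) \<and> (\<exists>K. compact K \<and> K \<subseteq> \<Omega> \<and> (\<forall>x. x \<notin> K \<longrightarrow> \<phi> x = 0))"
proof
  assume "\<phi> \<in> test_functions \<Omega>"
  then show "(\<forall>k. Ck k \<phi>) \<and> (\<exists>K. compact K \<and> K \<subseteq> \<Omega> \<and> (\<forall>x. x \<notin> K \<longrightarrow> \<phi> x = 0))"
    using closure_subset[of "{x. \<phi> x \<noteq> 0}"]
    by (auto simp: test_functions_def intro!: exI[of _ "closure {x. \<phi> x \<noteq> 0}"])
next
  assume *: "(\<forall>k. Ck k \<phi>) \<and> (\<exists>K. compact K \<and> K \<subseteq> \<Omega> \<and> (\<forall>x. x \<notin> K \<longrightarrow> \<phi> x = 0))"
  then obtain K where K: "compact K" "K \<subseteq> \<Omega>" "\<forall>x. x \<notin> K \<longrightarrow> \<phi> x = 0"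
    by blast
  have "closure {x. \<phi> x \<noteq> 0} \<subseteq> K"
    using K by (intro closure_minimal compact_imp_closed) auto
  moreover have "compact (closure {x. \<phi> x \<noteq> 0})"
    unfolding compact_closure by (rule bounded_subset[OF compact_imp_bounded[OF K(1)]]) (use K(3) in auto)
  ultimately show "\<phi> \<in> test_functions \<Omega>"
    using * K(2) by (auto simp: test_functions_def)
qed

lemma test_functions_mono: "\<phi> \<in> test_functions A \<Longrightarrow> A \<subseteq> B \<Longrightarrow> \<phi> \<in> test_functions B"
  by (auto simp: test_functions_def)

lemma test_functions_Ck: "\<phi> \<in> test_functions \<Omega> \<Longrightarrow> Ck k \<phi>"
  by (simp add: test_functions_def)

lemma GDERIV_test_function: "\<phi> \<in> test_functions \<Omega> \<Longrightarrow> GDERIV \<phi> x :> grad \<phi> x"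
  by (rule Ck_SucE(1)[OF test_functions_Ck])

lemma continuous_on_grad:
  assumes "Ck (Suc 0) f"
  shows "continuous_on UNIV (grad f)"
proof -
  have "continuous_on UNIV (\<lambda>x. \<Sum>b\<in>Basis. (b \<bullet> grad f x) *\<^sub>R b)"
    by (intro continuous_intros Ck_imp_continuous[OF Ck_SucE(2)[OF assms]])
  then show ?thesis
    by (simp add: inner_commute[of _ "grad f _"] euclidean_representation)
qed

lemma continuous_on_test_function:
  assumes "\<phi> \<in> test_functions \<Omega>"
  shows "continuous_on UNIV \<phi>" "continuous_on UNIV (grad \<phi>)"
  using assms by (auto intro: continuous_on_grad Ck_imp_continuous test_functions_Ck simp del: Ck.simps)

lemma test_functions_mult:
  assumes "\<phi> \<in> test_functions \<Omega>" "\<psi> \<in> test_functions \<Omega>"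
  shows "(\<lambda>x. \<phi> x * \<psi> x) \<in> test_functions \<Omega>"
  using assms unfolding test_functions_iff by (auto intro: Ck_mult)

text \<open>\<Omega> and the complement of \<open>K\<close> are open and cover the space; the
  function is \<open>f\<close> on the first and zero on the second, so \<open>Ck_local\<close>
  applies. Outside \<Omega> the values of \<open>f\<close> are arbitrary, which matters for periodic
  products of sines.\<close>

lemma test_functions_cutoff:
  assumes "open \<Omega>" "compact K" "K \<subseteq> \<Omega>" "\<And>k. Ck k f" "\<And>x. x \<in> \<Omega> \<Longrightarrow> x \<notin> K \<Longrightarrow> f x = 0"
  shows "(\<lambda>x. if x \<in> \<Omega> then f x else 0) \<in> test_functions \<Omega>"
proof -
  have "Ck k (\<lambda>x. if x \<in> \<Omega> then f x else 0)" for k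
  proof (rule Ck_local)
    fix x
    show "\<exists>U g. open U \<and> x \<in> U \<and> Ck k g \<and> (\<forall>y\<in>U. (if y \<in> \<Omega> then f y else 0) = g y)"
    proof (cases "x \<in> \<Omega>")
      case True
      with assms show ?thesis
        by (intro exI[of _ \<Omega>] exI[of _ f]) auto
    next
      case False
      with assms show ?thesis
        by (intro exI[of _ "- K"] exI[of _ "\<lambda>_. 0"]) (auto simp: compact_imp_closed)
    qed
  qed
  with assms show ?thesis
    by (auto simp: test_functions_iff)
qed

lemma grad_cutoff:
  assumes "open \<Omega>" "x \<in> \<Omega>" "GDERIV f x :> D"
  shows "grad (\<lambda>x. if x \<in> \<Omega> then f x else 0) x = D"
  using assms(3) unfolding gderiv_def
  by (intro GDERIV_frechet(3)[unfolded gderiv_def]) (rule has_derivative_transform_within_open[OF _ assms(1,2)], auto)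

section \<open>Integration by parts without boundary terms\<close>

lemma integrable_continuous_compact_support:
  fixes f :: "'a::euclidean_space \<Rightarrow> real"
  assumes "continuous_on UNIV f" "compact K" "\<And>x. x \<notin> K \<Longrightarrow> f x = 0"
  shows "integrable lborel f"
proof -
  have "integrable lborel (\<lambda>x. indicator K x *\<^sub>R f x)"
    using assms by (intro borel_integrable_compact) (auto intro: continuous_on_subset)
  also have "(\<lambda>x. indicator K x *\<^sub>R f x) = f"
    using assms(3) by (fastforce simp: indicator_def)
  finally show ?thesis .
qed

lemma integral_translate:
  fixes f :: "'a::euclidean_space \<Rightarrow> real"
  assumes "integrable lborel f"
  shows "integrable lborel (\<lambda>x. f (c + x))" "(\<integral>x. f (c + x) \<partial>lborel) = (\<integral>x. f x \<partial>lborel)"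
proof -
  have "integrable (distr lborel borel ((+) c)) f"
    using assms by (simp add: lborel_distr_plus)
  then show "integrable lborel (\<lambda>x. f (c + x))"
    by (subst (asm) integrable_distr_eq) (use assms in auto)
  have "(\<integral>x. f x \<partial>distr lborel borel ((+) c)) = (\<integral>x. f (c + x) \<partial>lborel)"
    by (rule integral_distr) (use assms in auto)
  then show "(\<integral>x. f (c + x) \<partial>lborel) = (\<integral>x. f x \<partial>lborel)"
    by (simp add: lborel_distr_plus)
qed

text \<open>
  By translation invariance the difference quotients of \<open>F\<close> have integral zero, and they converge
  boundedly to the derivative.
\<close>

lemma integral_partial_derivative_eq_0:
  fixes F :: "'a::euclidean_space \<Rightarrow> real"
  assumes F: "\<And>x. (F has_derivative F' x) (at x)" and cont: "continuous_on UNIV (\<lambda>x. F' x b)"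
    and K: "compact K" "\<And>x. x \<notin> K \<Longrightarrow> F x = 0"
  shows "(\<integral>x. F' x b \<partial>lborel) = 0" "\<And>x. x \<notin> K \<Longrightarrow> F' x b = 0"
proof -
  show F'0: "F' x b = 0" if "x \<notin> K" for x
  proof -
    have "(F has_derivative (\<lambda>_. 0)) (at x)"
      by (rule has_derivative_transform_within_open[of "\<lambda>_. 0" _ _ _ "- K"])
        (use that K compact_imp_closed in auto)
    then have "F' x = (\<lambda>_. 0)"
      by (rule has_derivative_unique[OF F])
    then show ?thesis
      by simp
  qed
  have "bounded ((\<lambda>x. F' x b) ` K)"
    using cont K(1) by (intro compact_imp_bounded compact_continuous_image) (auto intro: continuous_on_subset)
  then obtain B where B: "0 < B" "\<And>x. x \<in> K \<Longrightarrow> \<bar>F' x b\<bar> \<le> B"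
    by (auto simp: bounded_pos)
  then have B': "\<bar>F' x b\<bar> \<le> B" for x
    using F'0 by (cases "x \<in> K") auto
  obtain R where R: "\<And>x. x \<in> K \<Longrightarrow> norm x \<le> R"
    using compact_imp_bounded[OF K(1)] by (auto simp: bounded_iff)
  have contF: "continuous_on UNIV F"
    by (intro continuous_at_imp_continuous_on ballI has_derivative_continuous[OF F])
  have intF: "integrable lborel F"
    by (rule integrable_continuous_compact_support[OF contF K])
  \<comment> \<open>\<open>Suc n\<close> keeps the step in (0, 1]. Hence a shift moves points by at
    most \<open>norm b\<close>, and every quotient vanishes outside the ball of radius
    \<open>R + norm b\<close>, which carries the dominating function.\<close>
  define D where "D n x = (F (inverse (real (Suc n)) *\<^sub>R b + x) - F x) / inverse (real (Suc n))" for n x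
  have line: "((\<lambda>t. F (t *\<^sub>R b + x)) has_real_derivative F' (t *\<^sub>R b + x) b) (at t)" for x t
  proof -
    have "((\<lambda>t. F (t *\<^sub>R b + x)) has_derivative (\<lambda>h. F' (t *\<^sub>R b + x) (h *\<^sub>R b))) (at t)"
      by (rule has_derivative_compose[OF _ F]) (auto intro!: derivative_eq_intros)
    also have "(\<lambda>h. F' (t *\<^sub>R b + x) (h *\<^sub>R b)) = (*) (F' (t *\<^sub>R b + x) b)"
      by (simp add: fun_eq_iff linear_scale[OF has_derivative_linear[OF F]] mult.commute)
    finally show ?thesis
      by (simp add: has_field_derivative_def)
  qed
  have "(\<lambda>n. \<integral>x. D n x \<partial>lborel) \<longlonglongrightarrow> (\<integral>x. F' x b \<partial>lborel)"
  proof (rule integral_dominated_convergence)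
    show "(\<lambda>x. F' x b) \<in> borel_measurable lborel"
      using cont by (simp add: borel_measurable_continuous_onI)
    show "D n \<in> borel_measurable lborel" for n
      unfolding D_def using borel_measurable_continuous_onI[OF contF] by measurable
    show "integrable lborel (\<lambda>x::'a. indicator (cball 0 (R + norm b)) x *\<^sub>R B)"
      by (intro borel_integrable_compact) auto
    show "AE x in lborel. (\<lambda>n. D n x) \<longlonglongrightarrow> F' x b"
    proof (rule AE_I2)
      fix x
      have "(\<lambda>h. (F ((0 + h) *\<^sub>R b + x) - F (0 *\<^sub>R b + x)) / h) \<midarrow>0\<rightarrow> F' x b"
        using line[of x 0] by (simp add: DERIV_def)
      moreover have "filterlim (\<lambda>n. inverse (real (Suc n))) (at 0) sequentially"
        using LIMSEQ_inverse_real_of_nat by (simp add: filterlim_at)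
      ultimately show "(\<lambda>n. D n x) \<longlonglongrightarrow> F' x b"
        unfolding D_def using filterlim_compose by fastforce
    qed
    show "AE x in lborel. norm (D n x) \<le> indicator (cball 0 (R + norm b)) x *\<^sub>R B" for n
    proof (rule AE_I2)
      fix x
      define h where "h = inverse (real (Suc n))"
      have h: "0 < h" "h \<le> 1"
        by (auto simp: h_def inverse_le_1_iff)
      have Dn: "D n x = (F (h *\<^sub>R b + x) - F x) / h"
        by (simp only: D_def h_def)
      have "\<exists>t. 0 < t \<and> t < h \<and> F (h *\<^sub>R b + x) - F (0 *\<^sub>R b + x) = (h - 0) * F' (t *\<^sub>R b + x) b"
        by (rule MVT2[OF h(1)]) (rule line)
      then obtain t where "F (h *\<^sub>R b + x) - F x = h * F' (t *\<^sub>R b + x) b"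
        by auto
      then have le: "\<bar>D n x\<bar> \<le> B"
        using h B' by (simp add: Dn)
      show "norm (D n x) \<le> indicator (cball 0 (R + norm b)) x *\<^sub>R B"
      proof (cases "norm x \<le> R + norm b")
        case False
        then have "x \<notin> K"
          using R[of x] norm_ge_zero[of b] by linarith
        moreover have "h *\<^sub>R b + x \<notin> K"
        proof
          assume "h *\<^sub>R b + x \<in> K"
          moreover have "norm x \<le> norm (h *\<^sub>R b + x) + norm (h *\<^sub>R b)"
            by (metis add_diff_cancel_left' norm_triangle_ineq4)
          moreover have "norm (h *\<^sub>R b) \<le> norm b"
            using h by (simp add: mult_left_le_one_le)
          ultimately show False
            using False R[of "h *\<^sub>R b + x"] by linarith
        qed
        ultimately show ?thesis
          using K(2) False by (simp add: Dn)
      qed (use le in simp)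
    qed
  qed
  moreover have "(\<integral>x. D n x \<partial>lborel) = 0" for n
    unfolding D_def by (simp add: integral_translate intF)
  ultimately show "(\<integral>x. F' x b \<partial>lborel) = 0"
    by (simp add: LIMSEQ_const_iff)
qed

lemma integral_lebesgue_on_eq:
  fixes f :: "'a::euclidean_space \<Rightarrow> real"
  assumes "continuous_on UNIV f" "open \<Omega>" "\<And>x. x \<notin> \<Omega> \<Longrightarrow> f x = 0"
  shows "(\<integral>x. f x \<partial>lebesgue_on \<Omega>) = (\<integral>x. f x \<partial>lborel)"
proof -
  have "(\<integral>x. f x \<partial>lebesgue_on \<Omega>) = (\<integral>x. indicator \<Omega> x *\<^sub>R f x \<partial>lebesgue)"
    using assms by (intro integral_restrict_space) auto
  also have "(\<lambda>x. indicator \<Omega> x *\<^sub>R f x) = f"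
    using assms(3) by (fastforce simp: indicator_def)
  also have "(\<integral>x. f x \<partial>lebesgue) = (\<integral>x. f x \<partial>lborel)"
    using assms(1) by (intro integral_completion) (simp add: borel_measurable_continuous_onI)
  finally show ?thesis .
qed

lemma integrable_continuous_bounded:
  fixes f :: "'a::euclidean_space \<Rightarrow> real"
  assumes "continuous_on UNIV f" "open \<Omega>" "bounded \<Omega>"
  shows "integrable (lebesgue_on \<Omega>) f"
proof -
  have "integrable lborel (\<lambda>x. indicator (closure \<Omega>) x *\<^sub>R f x)"
    using assms by (intro borel_integrable_compact) (auto intro: continuous_on_subset)
  from integrable_mult_indicator[OF _ this, of \<Omega>]
  have "integrable lborel (\<lambda>x. indicator \<Omega> x *\<^sub>R (indicator (closure \<Omega>) x *\<^sub>R f x))"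
    using assms(2) by auto
  also have "(\<lambda>x. indicator \<Omega> x *\<^sub>R (indicator (closure \<Omega>) x *\<^sub>R f x)) = (\<lambda>x. indicator \<Omega> x *\<^sub>R f x)"
    using closure_subset[of \<Omega>] by (auto simp: indicator_def fun_eq_iff)
  finally have "integrable lebesgue (\<lambda>x. indicator \<Omega> x *\<^sub>R f x)"
    by (simp add: integrable_completion)
  then show ?thesis
    using assms(2) by (subst integrable_restrict_space) auto
qed

text \<open>For each basis vector \<open>b\<close> the derivative of
  \<open>\<eta> x * (V x \<bullet> b)\<close> in direction \<open>b\<close> has integral zero, and
  summation over \<open>b\<close> gives the claim. The factor \<eta> supplies the compact support,
  so \<open>V\<close> may be any field on the whole space: the identity, a gradient, or a test
  function times a constant vector.\<close>

lemma test_function_divergence: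
  fixes V :: "'a::euclidean_space \<Rightarrow> 'a"
  assumes \<Omega>: "open \<Omega>" "bounded \<Omega>" and \<eta>: "\<eta> \<in> test_functions \<Omega>"
    and V: "\<And>x. (V has_derivative V' x) (at x)"
    and V': "\<And>b. b \<in> Basis \<Longrightarrow> continuous_on UNIV (\<lambda>x. V' x b)"
  shows "(\<integral>x. grad \<eta> x \<bullet> V x \<partial>lebesgue_on \<Omega>)
      = - (\<integral>x. \<eta> x * (\<Sum>b\<in>Basis. V' x b \<bullet> b) \<partial>lebesgue_on \<Omega>)"
proof -
  obtain K where K: "compact K" "K \<subseteq> \<Omega>" "\<forall>x. x \<notin> K \<longrightarrow> \<eta> x = 0"
    using \<eta> unfolding test_functions_iff by blast
  have contV: "continuous_on UNIV V"
    by (intro continuous_at_imp_continuous_on ballI has_derivative_continuous[OF V])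
  note cont = continuous_on_test_function[OF \<eta>]
  have c1: "continuous_on UNIV (\<lambda>x. grad \<eta> x \<bullet> V x)"
    by (intro continuous_intros cont contV)
  have c2: "continuous_on UNIV (\<lambda>x. \<eta> x * (\<Sum>b\<in>Basis. V' x b \<bullet> b))"
    by (intro continuous_intros cont V')
  have cb: "continuous_on UNIV (\<lambda>x. \<eta> x * (V' x b \<bullet> b) + (b \<bullet> grad \<eta> x) * (V x \<bullet> b))" if "b \<in> Basis" for b
    by (intro continuous_intros cont contV V' that)
  have der: "((\<lambda>x. \<eta> x * (V x \<bullet> b)) has_derivative
      (\<lambda>h. \<eta> x * (V' x h \<bullet> b) + (h \<bullet> grad \<eta> x) * (V x \<bullet> b))) (at x)" for x b
    using GDERIV_test_function[OF \<eta>, of x] V[of x]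
    unfolding gderiv_def by (auto intro!: derivative_eq_intros)
  have zero: "(\<integral>x. \<eta> x * (V' x b \<bullet> b) + (b \<bullet> grad \<eta> x) * (V x \<bullet> b) \<partial>lebesgue_on \<Omega>) = 0" if b: "b \<in> Basis" for b
  proof -
    have K0: "\<eta> x * (V x \<bullet> b) = 0" if "x \<notin> K" for x
      using that K(3) by simp
    note 0 = integral_partial_derivative_eq_0[OF der cb[OF b] K(1) K0]
    have "\<eta> x * (V' x b \<bullet> b) + (b \<bullet> grad \<eta> x) * (V x \<bullet> b) = 0" if "x \<notin> \<Omega>" for x
      using 0(2) K(2) that by blast
    then show ?thesis
      using 0(1) integral_lebesgue_on_eq[OF cb[OF b] \<Omega>(1)] by simp
  qed
  have "(\<integral>x. \<eta> x * (\<Sum>b\<in>Basis. V' x b \<bullet> b) \<partial>lebesgue_on \<Omega>) + (\<integral>x. grad \<eta> x \<bullet> V x \<partial>lebesgue_on \<Omega>)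
      = (\<integral>x. \<eta> x * (\<Sum>b\<in>Basis. V' x b \<bullet> b) + grad \<eta> x \<bullet> V x \<partial>lebesgue_on \<Omega>)"
    by (rule Bochner_Integration.integral_add[symmetric]) (auto intro: integrable_continuous_bounded c1 c2 \<Omega>)
  also have "\<dots> = (\<integral>x. (\<Sum>b\<in>Basis. \<eta> x * (V' x b \<bullet> b) + (b \<bullet> grad \<eta> x) * (V x \<bullet> b)) \<partial>lebesgue_on \<Omega>)"
    by (simp add: sum.distrib sum_distrib_left euclidean_inner[of "grad \<eta> _" "V _"] inner_commute[of _ "grad \<eta> _"])
  also have "\<dots> = (\<Sum>b\<in>Basis. \<integral>x. \<eta> x * (V' x b \<bullet> b) + (b \<bullet> grad \<eta> x) * (V x \<bullet> b) \<partial>lebesgue_on \<Omega>)"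
    by (rule Bochner_Integration.integral_sum) (auto intro: integrable_continuous_bounded cb \<Omega>)
  finally show ?thesis
    by (simp add: zero)
qed

lemma square_integrable_continuous:
  fixes f :: "'a::euclidean_space \<Rightarrow> 'b::euclidean_space"
  assumes "continuous_on UNIV f" "open \<Omega>" "bounded \<Omega>"
  shows "square_integrable \<Omega> f"
proof -
  have "f \<in> borel_measurable borel"
    using assms by (simp add: borel_measurable_continuous_onI)
  then have "f \<in> borel_measurable (lebesgue_on \<Omega>)"
    by (intro measurable_restrict_space1 measurable_completion) simp
  then show ?thesis
    unfolding square_integrable_def using assms
    by (auto intro!: integrable_continuous_bounded continuous_intros)
qed

text \<open>The weak gradient identity is the divergence identity for the field
  \<open>\<phi> x *\<^sub>R b\<close>, and the constant sequence approximates.\<close>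

lemma H01_grad_test_function:
  assumes \<Omega>: "open \<Omega>" "bounded \<Omega>" and \<eta>: "\<eta> \<in> test_functions \<Omega>"
  shows "H01_grad \<Omega> \<eta> (grad \<eta>)"
proof -
  have "(\<integral>x. \<eta> x * frechet_derivative \<phi> (at x) b \<partial>lebesgue_on \<Omega>)
      = - (\<integral>x. (grad \<eta> x \<bullet> b) * \<phi> x \<partial>lebesgue_on \<Omega>)"
    if \<phi>: "\<phi> \<in> test_functions \<Omega>" and b: "b \<in> Basis" for \<phi> b
  proof -
    note g\<phi> = GDERIV_test_function[OF \<phi>]
    have "((\<lambda>x. \<phi> x *\<^sub>R b) has_derivative (\<lambda>h. (h \<bullet> grad \<phi> x) *\<^sub>R b)) (at x)" for x
      using g\<phi>[of x] unfolding gderiv_def by (auto intro!: derivative_eq_intros)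
    moreover have "continuous_on UNIV (\<lambda>x. (c \<bullet> grad \<phi> x) *\<^sub>R b)" for c
      by (intro continuous_intros continuous_on_test_function[OF \<phi>])
    ultimately have "(\<integral>x. grad \<eta> x \<bullet> \<phi> x *\<^sub>R b \<partial>lebesgue_on \<Omega>)
        = - (\<integral>x. \<eta> x * (\<Sum>c\<in>Basis. (c \<bullet> grad \<phi> x) *\<^sub>R b \<bullet> c) \<partial>lebesgue_on \<Omega>)"
      by (rule test_function_divergence[OF \<Omega> \<eta>])
    moreover have "(\<Sum>c\<in>Basis. (c \<bullet> grad \<phi> x) *\<^sub>R b \<bullet> c) = b \<bullet> grad \<phi> x" for x
      unfolding euclidean_inner[of b "grad \<phi> x"] by (simp add: inner_commute[of _ "grad \<phi> x"] mult.commute)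
    ultimately show ?thesis
      by (simp add: GDERIV_frechet(2)[OF g\<phi>] mult.commute)
  qed
  then have "has_weak_grad \<Omega> \<eta> (grad \<eta>)"
    unfolding has_weak_grad_def
    by (intro conjI ballI square_integrable_continuous continuous_on_test_function[OF \<eta>] \<Omega>)
  then show ?thesis
    unfolding H01_grad_def using \<eta> by (auto intro!: exI[of _ "\<lambda>_. \<eta>"])
qed

text \<open>With \<open>V x = x\<close> the divergence theorem for \<open>\<eta>\<^sup>2\<close> reads
  \<open>DIM \<integral>\<eta>\<^sup>2 = - 2 \<integral>\<eta> (grad \<eta> \<bullet> x)\<close>.\<close>

lemma Poincare_test_function:
  fixes \<Omega> :: "'a::euclidean_space set"
  assumes \<Omega>: "open \<Omega>" "bounded \<Omega>"
  shows "\<exists>C. \<forall>\<eta>\<in>test_functions \<Omega>.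
    (\<integral>x. (\<eta> x)\<^sup>2 \<partial>lebesgue_on \<Omega>) \<le> C * (\<integral>x. (norm (grad \<eta> x))\<^sup>2 \<partial>lebesgue_on \<Omega>)"
proof -
  obtain B where B: "\<And>x. x \<in> \<Omega> \<Longrightarrow> norm x \<le> B" "B > 0"
    using \<Omega>(2) unfolding bounded_pos by blast
  show ?thesis
  proof (intro exI[of _ "4 * B\<^sup>2"] ballI)
    fix \<eta> assume \<eta>: "\<eta> \<in> test_functions \<Omega>"
    note cont = continuous_on_test_function[OF \<eta>]
    let ?\<eta>2 = "\<lambda>x. \<eta> x * \<eta> x"
    have "?\<eta>2 \<in> test_functions \<Omega>"
      by (intro test_functions_mult \<eta>)
    from test_function_divergence[OF \<Omega> this, of "\<lambda>x. x" "\<lambda>x h. h"]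
    have div: "(\<integral>x. grad ?\<eta>2 x \<bullet> x \<partial>lebesgue_on \<Omega>) = - (\<integral>x. \<eta> x * \<eta> x * real DIM('a) \<partial>lebesgue_on \<Omega>)"
      by simp
    have "(\<integral>x. \<eta> x * \<eta> x * real DIM('a) \<partial>lebesgue_on \<Omega>) = real DIM('a) * (\<integral>x. (\<eta> x)\<^sup>2 \<partial>lebesgue_on \<Omega>)"
      by (subst integral_mult_right_zero[symmetric]) (simp add: power2_eq_square mult.commute)
    note div = div[unfolded this]
    have grad2: "grad ?\<eta>2 x = \<eta> x *\<^sub>R grad \<eta> x + \<eta> x *\<^sub>R grad \<eta> x" for x
      by (intro GDERIV_frechet(3) GDERIV_mult GDERIV_test_function[OF \<eta>])
    have i1: "integrable (lebesgue_on \<Omega>) (\<lambda>x. (\<eta> x)\<^sup>2)"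
      and i2: "integrable (lebesgue_on \<Omega>) (\<lambda>x. (norm (grad \<eta> x))\<^sup>2)"
      and i3: "integrable (lebesgue_on \<Omega>) (\<lambda>x. - (2 * \<eta> x * (grad \<eta> x \<bullet> x)))"
      by (intro integrable_continuous_bounded continuous_intros cont \<Omega>)+
    have "1 * (\<integral>x. (\<eta> x)\<^sup>2 \<partial>lebesgue_on \<Omega>) \<le> real DIM('a) * (\<integral>x. (\<eta> x)\<^sup>2 \<partial>lebesgue_on \<Omega>)"
      by (intro mult_right_mono) (auto simp: Suc_le_eq)
    also have "\<dots> = (\<integral>x. - (2 * \<eta> x * (grad \<eta> x \<bullet> x)) \<partial>lebesgue_on \<Omega>)"
      using div by (simp add: grad2 inner_add_left mult.assoc)
    also have "\<dots> \<le> (\<integral>x. 1 / 2 * (\<eta> x)\<^sup>2 + 2 * B\<^sup>2 * (norm (grad \<eta> x))\<^sup>2 \<partial>lebesgue_on \<Omega>)"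
    proof (rule integral_mono)
      fix x assume "x \<in> space (lebesgue_on \<Omega>)"
      then have "norm x \<le> B"
        using B by simp
      then have "\<bar>grad \<eta> x \<bullet> x\<bar> \<le> norm (grad \<eta> x) * B"
        by (meson Cauchy_Schwarz_ineq2 mult_left_mono norm_ge_zero order_trans)
      then have "\<bar>grad \<eta> x \<bullet> x\<bar>\<^sup>2 \<le> (norm (grad \<eta> x) * B)\<^sup>2"
        by (intro power_mono) auto
      \<comment> \<open>The weights leave half of the integral of \<eta>^2 on the right, where it is
        absorbed; this yields the constant \<open>4 * B\<^sup>2\<close>.\<close>
      moreover have "- (2 * a * b) \<le> 1 / 2 * a\<^sup>2 + 2 * \<bar>b\<bar>\<^sup>2" for a b :: real
        using zero_le_power2[of "a + 2 * b"] by (simp add: power2_sum power_mult_distrib)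
      ultimately show "- (2 * \<eta> x * (grad \<eta> x \<bullet> x)) \<le> 1 / 2 * (\<eta> x)\<^sup>2 + 2 * B\<^sup>2 * (norm (grad \<eta> x))\<^sup>2"
        unfolding power_mult_distrib mult.assoc mult.commute[of "B\<^sup>2"]
        by (meson add_left_mono mult_left_mono order_trans zero_le_numeral)
    qed (use i1 i2 i3 in auto)
    also have "\<dots> = 1 / 2 * (\<integral>x. (\<eta> x)\<^sup>2 \<partial>lebesgue_on \<Omega>) + 2 * B\<^sup>2 * (\<integral>x. (norm (grad \<eta> x))\<^sup>2 \<partial>lebesgue_on \<Omega>)"
      using i1 i2 by simp
    finally show "(\<integral>x. (\<eta> x)\<^sup>2 \<partial>lebesgue_on \<Omega>) \<le> 4 * B\<^sup>2 * (\<integral>x. (norm (grad \<eta> x))\<^sup>2 \<partial>lebesgue_on \<Omega>)"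
      by simp
  qed
qed

section \<open>The weak maximum principle\<close>

lemma square_integrableD:
  assumes "square_integrable \<Omega> f"
  shows "f \<in> borel_measurable (lebesgue_on \<Omega>)" "integrable (lebesgue_on \<Omega>) (\<lambda>x. (norm (f x))\<^sup>2)"
  using assms by (auto simp: square_integrable_def)

lemma square_integrable_inner:
  assumes "square_integrable \<Omega> f" "square_integrable \<Omega> g"
  shows "integrable (lebesgue_on \<Omega>) (\<lambda>x. f x \<bullet> g x)"
proof (rule Bochner_Integration.integrable_bound)
  show "integrable (lebesgue_on \<Omega>) (\<lambda>x. (norm (f x))\<^sup>2 + (norm (g x))\<^sup>2)"
    using assms by (auto simp: square_integrable_def)
  show "(\<lambda>x. f x \<bullet> g x) \<in> borel_measurable (lebesgue_on \<Omega>)"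
    using assms by (auto simp: square_integrable_def)
  have "\<bar>f x \<bullet> g x\<bar> \<le> (norm (f x))\<^sup>2 + (norm (g x))\<^sup>2" for x
  proof -
    have "\<bar>f x \<bullet> g x\<bar> \<le> norm (f x) * norm (g x)"
      by (rule Cauchy_Schwarz_ineq2)
    also have "\<dots> \<le> (norm (f x))\<^sup>2 + (norm (g x))\<^sup>2"
      using sum_squares_bound[of "norm (f x)" "norm (g x)"] mult_nonneg_nonneg[OF norm_ge_zero[of "f x"] norm_ge_zero[of "g x"]]
      by linarith
    finally show ?thesis .
  qed
  then show "AE x in lebesgue_on \<Omega>. norm (f x \<bullet> g x) \<le> norm ((norm (f x))\<^sup>2 + (norm (g x))\<^sup>2)"
    by simp
qed

lemma square_integrable_diff:
  fixes f g :: "'a::euclidean_space \<Rightarrow> 'b::euclidean_space"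
  assumes "square_integrable \<Omega> f" "square_integrable \<Omega> g"
  shows "square_integrable \<Omega> (\<lambda>x. f x - g x)"
proof -
  have "(\<lambda>x. (norm (f x - g x))\<^sup>2) = (\<lambda>x. (norm (f x))\<^sup>2 + (norm (g x))\<^sup>2 - 2 * (f x \<bullet> g x))"
    by (simp add: power2_norm_eq_inner inner_diff_left inner_diff_right inner_commute fun_eq_iff)
  moreover have "integrable (lebesgue_on \<Omega>) (\<lambda>x. (norm (f x))\<^sup>2 + (norm (g x))\<^sup>2 - 2 * (f x \<bullet> g x))"
    using square_integrableD(2)[OF assms(1)] square_integrableD(2)[OF assms(2)] square_integrable_inner[OF assms]
    by simp
  moreover have "(\<lambda>x. f x - g x) \<in> borel_measurable (lebesgue_on \<Omega>)"
    using assms[THEN square_integrableD(1)] by measurable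
  ultimately show ?thesis
    by (simp add: square_integrable_def)
qed

text \<open>
  Testing with \<open>\<eta> n = soft_pos (\<phi> n - \<psi>)\<close>, for which
  \<open>\<bar>grad \<eta>\<bar>\<^sup>2 \<le> (grad \<phi> - grad \<psi>) \<bullet> grad \<eta>\<close>, shows that \<open>grad (\<eta> n)\<close> tends to 0 in \<open>L\<^sup>2\<close>.
\<close>

lemma weak_maximum_principle:
  fixes \<Omega> :: "'a::euclidean_space set"
  assumes \<Omega>: "open \<Omega>" "bounded \<Omega>"
    and u: "square_integrable \<Omega> u" and h: "square_integrable \<Omega> h"
    and \<phi>: "\<And>n. \<phi> n \<in> test_functions \<Omega>"
    and conv: "(\<lambda>n::nat. (\<integral>x. (\<phi> n x - u x)\<^sup>2 \<partial>lebesgue_on \<Omega>)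
         + (\<integral>x. (norm (grad (\<phi> n) x - h x))\<^sup>2 \<partial>lebesgue_on \<Omega>)) \<longlonglongrightarrow> 0"
    and \<psi>: "\<And>k. Ck k \<psi>" "\<And>x. x \<in> \<Omega> \<Longrightarrow> 0 \<le> \<psi> x"
    and sub: "\<And>\<eta>. \<eta> \<in> test_functions \<Omega> \<Longrightarrow> (\<And>x. 0 \<le> \<eta> x) \<Longrightarrow>
        (\<integral>x. (h x - grad \<psi> x) \<bullet> grad \<eta> x \<partial>lebesgue_on \<Omega>) \<le> 0"
  shows "AE x in lebesgue_on \<Omega>. u x \<le> \<psi> x"
proof -
  let ?M = "lebesgue_on \<Omega>"
  define d where "d n = (\<integral>x. (norm (grad (\<phi> n) x - h x))\<^sup>2 \<partial>?M)" for n
  define e where "e n = (\<integral>x. (\<phi> n x - u x)\<^sup>2 \<partial>?M)" for n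
  define \<eta> where "\<eta> n x = (if x \<in> \<Omega> then soft_pos (\<phi> n x - \<psi> x) else 0)" for n x
  obtain C where C: "\<And>\<eta>. \<eta> \<in> test_functions \<Omega> \<Longrightarrow>
      (\<integral>x. (\<eta> x)\<^sup>2 \<partial>?M) \<le> C * (\<integral>x. (norm (grad \<eta> x))\<^sup>2 \<partial>?M)"
    using Poincare_test_function[OF \<Omega>] by auto
  have g\<psi>: "GDERIV \<psi> x :> grad \<psi> x" for x
    by (rule Ck_SucE(1)[OF \<psi>(1)])
  have sq\<psi>: "square_integrable \<Omega> \<psi>" "square_integrable \<Omega> (grad \<psi>)"
    by (intro square_integrable_continuous continuous_on_grad Ck_imp_continuous \<psi> \<Omega>)+
  \<comment> \<open>The boundary comparison enters here: since \<psi> is nonnegative on \<Omega>,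
    the truncation vanishes wherever \<open>\<phi> n\<close> does and inherits its compact
    set.\<close>
  have \<eta>_test: "\<eta> n \<in> test_functions \<Omega>" for n
  proof -
    obtain K where "compact K" "K \<subseteq> \<Omega>" "\<forall>x. x \<notin> K \<longrightarrow> \<phi> n x = 0"
      using \<phi>[of n] unfolding test_functions_iff by blast
    then show ?thesis
      unfolding \<eta>_def[abs_def] using \<psi>(2)
      by (intro test_functions_cutoff[of _ K] Ck_compose[OF Ck_soft_pos] Ck_diff test_functions_Ck[OF \<phi>] \<psi> \<Omega>)
        (auto simp: soft_pos_eq_0_iff)
  qed
  have grad_\<eta>: "grad (\<eta> n) x = soft_pos' (\<phi> n x - \<psi> x) *\<^sub>R (grad (\<phi> n) x - grad \<psi> x)" if "x \<in> \<Omega>" for n x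
    unfolding \<eta>_def[abs_def]
    by (intro grad_cutoff \<Omega> that GDERIV_DERIV_compose GDERIV_diff GDERIV_test_function[OF \<phi>] g\<psi> DERIV_soft_pos)
  have sq_\<eta>: "square_integrable \<Omega> (\<eta> n)" "square_integrable \<Omega> (grad (\<eta> n))" for n
    by (intro square_integrable_continuous continuous_on_test_function[OF \<eta>_test] \<Omega>)+
  have sq_d: "square_integrable \<Omega> (\<lambda>x. grad (\<phi> n) x - h x)" for n
    by (intro square_integrable_diff h square_integrable_continuous continuous_on_test_function[OF \<phi>] \<Omega>)
  have sq_e: "square_integrable \<Omega> (\<lambda>x. \<phi> n x - u x)" for n
    by (intro square_integrable_diff u square_integrable_continuous continuous_on_test_function[OF \<phi>] \<Omega>)
  have sq_a: "square_integrable \<Omega> (\<lambda>x. h x - grad \<psi> x)"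
    by (intro square_integrable_diff h sq\<psi>)
  have grad_le: "(\<integral>x. (norm (grad (\<eta> n) x))\<^sup>2 \<partial>?M) \<le> d n" for n
  proof -
    have "(\<integral>x. (norm (grad (\<eta> n) x))\<^sup>2 \<partial>?M) \<le>
        (\<integral>x. (h x - grad \<psi> x) \<bullet> grad (\<eta> n) x + (grad (\<phi> n) x - h x) \<bullet> grad (\<eta> n) x \<partial>?M)"
    proof (rule integral_mono)
      fix x assume "x \<in> space ?M"
      then have "x \<in> \<Omega>"
        by simp
      define c where "c = soft_pos' (\<phi> n x - \<psi> x)"
      have c: "0 \<le> c" "c \<le> 1"
        by (auto simp: c_def soft_pos'_bounds)
      let ?w = "grad (\<phi> n) x - grad \<psi> x"
      have "(norm (grad (\<eta> n) x))\<^sup>2 = c * (c * (?w \<bullet> ?w))"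
        unfolding grad_\<eta>[OF \<open>x \<in> \<Omega>\<close>] power2_norm_eq_inner by (simp add: c_def)
      also have "\<dots> \<le> c * (?w \<bullet> ?w)"
        using c by (intro mult_left_mono mult_left_le_one_le) auto
      also have "\<dots> = (h x - grad \<psi> x) \<bullet> grad (\<eta> n) x + (grad (\<phi> n) x - h x) \<bullet> grad (\<eta> n) x"
        unfolding grad_\<eta>[OF \<open>x \<in> \<Omega>\<close>] inner_add_left[symmetric] by (simp add: c_def)
      finally show "(norm (grad (\<eta> n) x))\<^sup>2 \<le> (h x - grad \<psi> x) \<bullet> grad (\<eta> n) x + (grad (\<phi> n) x - h x) \<bullet> grad (\<eta> n) x" .
    qed (intro Bochner_Integration.integrable_add square_integrable_inner square_integrableD sq_\<eta> sq_d sq_a)+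
    also have "\<dots> = (\<integral>x. (h x - grad \<psi> x) \<bullet> grad (\<eta> n) x \<partial>?M) + (\<integral>x. (grad (\<phi> n) x - h x) \<bullet> grad (\<eta> n) x \<partial>?M)"
      by (intro Bochner_Integration.integral_add square_integrable_inner sq_\<eta> sq_d sq_a)
    \<comment> \<open>The differential inequality \<open>sub\<close> is known for \<open>h\<close>
      rather than for \<open>grad (\<phi> n)\<close>. It removes the first term because
      \<open>\<eta> n\<close> is nonnegative; the error of the replacement costs
      \<open>d n / 2\<close> plus half of the left-hand side, which is absorbed.\<close>
    also have "\<dots> \<le> 0 + (\<integral>x. 1 / 2 * (norm (grad (\<phi> n) x - h x))\<^sup>2 + 1 / 2 * (norm (grad (\<eta> n) x))\<^sup>2 \<partial>?M)"
    proof (intro add_mono sub \<eta>_test integral_mono square_integrable_inner sq_\<eta> sq_d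
        Bochner_Integration.integrable_add integrable_mult_right square_integrableD)
      show "0 \<le> \<eta> n x" for x
        by (simp add: \<eta>_def soft_pos_nonneg)
      show "a \<bullet> b \<le> 1 / 2 * (norm a)\<^sup>2 + 1 / 2 * (norm b)\<^sup>2" for a b :: 'a
        using zero_le_power2[of "norm (a - b)"] unfolding power2_norm_eq_inner
        by (simp add: inner_diff_left inner_diff_right inner_commute)
    qed
    also have "\<dots> = 1 / 2 * d n + 1 / 2 * (\<integral>x. (norm (grad (\<eta> n) x))\<^sup>2 \<partial>?M)"
      using square_integrableD(2)[OF sq_d, of n] square_integrableD(2)[OF sq_\<eta>(2), of n] by (simp add: d_def)
    finally show ?thesis
      by simp
  qed
  have meas: "(\<lambda>x. soft_pos (u x - \<psi> x)) \<in> borel_measurable ?M"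
    using square_integrableD(1)[OF u] square_integrableD(1)[OF sq\<psi>(1)]
      borel_measurable_continuous_onI[OF Ck_imp_continuous[OF Ck_soft_pos]] by measurable
  \<comment> \<open>\<open>\<eta> n\<close> truncates \<open>\<phi> n\<close>, whereas the claim
    concerns \<open>u\<close>. Both terms on the right vanish in the limit after integration: the
    first by the Poincare inequality and \<open>grad_le\<close>, the second by
    \<open>conv\<close>.\<close>
  have pt: "(soft_pos (u x - \<psi> x))\<^sup>2 \<le> 2 * (\<eta> n x)\<^sup>2 + 2 * (\<phi> n x - u x)\<^sup>2" if "x \<in> \<Omega>" for n x
  proof -
    let ?s = "soft_pos (u x - \<psi> x)"
    have "\<bar>?s - \<eta> n x\<bar> \<le> \<bar>\<phi> n x - u x\<bar>"
      using soft_pos_Lipschitz[of "u x - \<psi> x" "\<phi> n x - \<psi> x"] that by (simp add: \<eta>_def abs_minus_commute)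
    then have "(?s - \<eta> n x)\<^sup>2 \<le> (\<phi> n x - u x)\<^sup>2"
      by (simp add: abs_le_square_iff)
    moreover have "s\<^sup>2 \<le> 2 * t\<^sup>2 + 2 * (s - t)\<^sup>2" for s t :: real
      using zero_le_power2[of "s - 2 * t"] by (simp add: power2_diff)
    from this[of ?s "\<eta> n x"] have "?s\<^sup>2 \<le> 2 * (\<eta> n x)\<^sup>2 + 2 * (?s - \<eta> n x)\<^sup>2" .
    ultimately show ?thesis
      by linarith
  qed
  have int_bd: "integrable ?M (\<lambda>x. 2 * (\<eta> n x)\<^sup>2 + 2 * (\<phi> n x - u x)\<^sup>2)" for n
    using square_integrableD(2)[OF sq_\<eta>(1), of n] square_integrableD(2)[OF sq_e, of n] by simp
  have int: "integrable ?M (\<lambda>x. (soft_pos (u x - \<psi> x))\<^sup>2)"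
    by (rule Bochner_Integration.integrable_bound[OF int_bd[of 0]])
      (use meas pt in \<open>auto intro!: AE_I2 simp: abs_of_nonneg\<close>)
  have le: "(\<integral>x. (soft_pos (u x - \<psi> x))\<^sup>2 \<partial>?M) \<le> (2 * \<bar>C\<bar> + 2) * (e n + d n)" for n
  proof -
    have d0: "0 \<le> d n" and e0: "0 \<le> e n"
      by (auto simp: d_def e_def)
    have "(\<integral>x. (\<eta> n x)\<^sup>2 \<partial>?M) \<le> C * (\<integral>x. (norm (grad (\<eta> n) x))\<^sup>2 \<partial>?M)"
      by (rule C[OF \<eta>_test])
    \<comment> \<open>\<open>C\<close> was obtained without a sign, hence the absolute
      value.\<close>
    also have "\<dots> \<le> \<bar>C\<bar> * (\<integral>x. (norm (grad (\<eta> n) x))\<^sup>2 \<partial>?M)"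
      by (intro mult_right_mono) auto
    also have "\<dots> \<le> \<bar>C\<bar> * d n"
      by (intro mult_left_mono grad_le) auto
    finally have *: "(\<integral>x. (\<eta> n x)\<^sup>2 \<partial>?M) \<le> \<bar>C\<bar> * d n" .
    have "(\<integral>x. (soft_pos (u x - \<psi> x))\<^sup>2 \<partial>?M) \<le> (\<integral>x. 2 * (\<eta> n x)\<^sup>2 + 2 * (\<phi> n x - u x)\<^sup>2 \<partial>?M)"
      by (intro integral_mono int int_bd pt) simp
    also have "\<dots> = 2 * (\<integral>x. (\<eta> n x)\<^sup>2 \<partial>?M) + 2 * e n"
      using square_integrableD(2)[OF sq_\<eta>(1), of n] square_integrableD(2)[OF sq_e, of n] by (simp add: e_def)
    also have "\<dots> \<le> 2 * (\<bar>C\<bar> * d n) + 2 * e n"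
      using * by simp
    also have "\<dots> \<le> (2 * \<bar>C\<bar> + 2) * (e n + d n)"
      using d0 e0 mult_nonneg_nonneg[OF abs_ge_zero[of C] e0] by (simp add: algebra_simps)
    finally show ?thesis .
  qed
  have "(\<lambda>n. (2 * \<bar>C\<bar> + 2) * (e n + d n)) \<longlonglongrightarrow> (2 * \<bar>C\<bar> + 2) * 0"
    using conv unfolding d_def e_def by (rule tendsto_mult_left)
  then have "(\<integral>x. (soft_pos (u x - \<psi> x))\<^sup>2 \<partial>?M) \<le> (2 * \<bar>C\<bar> + 2) * 0"
    by (rule LIMSEQ_le_const) (use le in blast)
  then have "(\<integral>x. (soft_pos (u x - \<psi> x))\<^sup>2 \<partial>?M) = 0"
    by (intro antisym integral_nonneg_AE) simp_all
  then have "AE x in ?M. (soft_pos (u x - \<psi> x))\<^sup>2 = 0"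
    using integral_nonneg_eq_0_iff_AE[OF int] by simp
  then show ?thesis
    by (simp add: soft_pos_eq_0_iff)
qed

text \<open>The barrier \<psi> is the torsion function of the infinite strip: its gradient field has
  divergence - (e \<bullet> e) = -1, it is nonnegative between the two lines, and its largest value,
  on the middle line, is \<open>(b - a)\<^sup>2 / 8\<close>.\<close>

lemma torsion_function_le_strip:
  fixes \<Omega> :: "'a::euclidean_space set"
  assumes \<Omega>: "open \<Omega>" "bounded \<Omega>" and v: "is_torsion_function \<Omega> v"
    and e: "norm e = 1" and ab: "\<And>x. x \<in> \<Omega> \<Longrightarrow> a \<le> e \<bullet> x \<and> e \<bullet> x \<le> b"
  shows "AE x in lebesgue_on \<Omega>. \<bar>v x\<bar> \<le> (b - a)\<^sup>2 / 8"
proof -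
  let ?M = "lebesgue_on \<Omega>"
  obtain g \<phi> where wg: "has_weak_grad \<Omega> v g"
    and eq: "\<And>\<phi>. \<phi> \<in> test_functions \<Omega> \<Longrightarrow> (\<integral>x. g x \<bullet> grad \<phi> x \<partial>?M) = (\<integral>x. \<phi> x \<partial>?M)"
    and \<phi>: "\<And>n::nat. \<phi> n \<in> test_functions \<Omega>"
    and conv: "(\<lambda>n. (\<integral>x. (\<phi> n x - v x)\<^sup>2 \<partial>?M) + (\<integral>x. (norm (grad (\<phi> n) x - g x))\<^sup>2 \<partial>?M)) \<longlonglongrightarrow> 0"
    using v unfolding is_torsion_function_def H01_grad_def by blast
  have sq: "square_integrable \<Omega> v" "square_integrable \<Omega> g"
    using wg by (auto simp: has_weak_grad_def)
  define \<psi> where "\<psi> x = (1 / 2) * ((e \<bullet> x - a) * (b - e \<bullet> x))" for x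
  have Ck\<psi>: "Ck k \<psi>" for k
    unfolding \<psi>_def[abs_def] by (intro Ck_cmult Ck_mult Ck_diff Ck_inner Ck_const)
  have \<psi>: "0 \<le> \<psi> x" "\<psi> x \<le> (b - a)\<^sup>2 / 8" if "x \<in> \<Omega>" for x
  proof -
    show "0 \<le> \<psi> x"
      using ab[OF that] by (simp add: \<psi>_def)
    show "\<psi> x \<le> (b - a)\<^sup>2 / 8"
      using zero_le_power2[of "2 * (e \<bullet> x) - a - b"] by (simp add: \<psi>_def power2_eq_square algebra_simps)
  qed
  let ?V = "\<lambda>x. ((a + b) / 2 - e \<bullet> x) *\<^sub>R e"
  have grad\<psi>: "grad \<psi> x = ?V x" for x
  proof (rule GDERIV_frechet(3))
    have "(\<psi> has_derivative (\<lambda>h. (1 / 2) * ((e \<bullet> x - a) * (- (e \<bullet> h)) + (e \<bullet> h) * (b - e \<bullet> x)))) (at x)"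
      unfolding \<psi>_def by (auto intro!: derivative_eq_intros)
    then show "GDERIV \<psi> x :> ?V x"
      unfolding gderiv_def by (rule has_derivative_eq_rhs) (auto simp: fun_eq_iff inner_commute algebra_simps)
  qed
  have \<psi>_eq: "(\<integral>x. grad \<psi> x \<bullet> grad \<eta> x \<partial>?M) = (\<integral>x. \<eta> x \<partial>?M)" if "\<eta> \<in> test_functions \<Omega>" for \<eta>
  proof -
    have "(?V has_derivative (\<lambda>h. (- (e \<bullet> h)) *\<^sub>R e)) (at x)" for x
      by (auto intro!: derivative_eq_intros)
    then have "(\<integral>x. grad \<eta> x \<bullet> ?V x \<partial>?M) = - (\<integral>x. \<eta> x * (\<Sum>b\<in>Basis. (- (e \<bullet> b)) *\<^sub>R e \<bullet> b) \<partial>?M)"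
      by (rule test_function_divergence[OF \<Omega> that]) auto
    also have "(\<Sum>b\<in>Basis. (- (e \<bullet> b)) *\<^sub>R e \<bullet> b) = - (e \<bullet> e)"
      unfolding euclidean_inner[of e e] by (simp add: sum_negf)
    also have "e \<bullet> e = 1"
      using e by (simp add: dot_square_norm)
    finally show ?thesis
      by (simp add: grad\<psi> inner_commute)
  qed
  \<comment> \<open>Both signs are treated at once. Subtracting the two weak equations leaves
    (\<sigma> - 1) times the integral of \<eta>, which is zero for \<sigma> = 1 and nonpositive for
    \<sigma> = -1.\<close>
  have main: "AE x in ?M. \<sigma> * v x \<le> \<psi> x" if \<sigma>: "\<sigma> = 1 \<or> \<sigma> = -1" for \<sigma> :: real
  proof (rule weak_maximum_principle[OF \<Omega>, where h="\<lambda>x. \<sigma> *\<^sub>R g x" and \<phi>="\<lambda>n x. \<sigma> * \<phi> n x"])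
    have \<sigma>2: "\<sigma>\<^sup>2 = 1" "\<bar>\<sigma>\<bar> = 1"
      using \<sigma> by auto
    show "square_integrable \<Omega> (\<lambda>x. \<sigma> * v x)" "square_integrable \<Omega> (\<lambda>x. \<sigma> *\<^sub>R g x)"
      using sq by (auto simp: square_integrable_def \<sigma>2 abs_mult power_mult_distrib)
    show "(\<lambda>x. \<sigma> * \<phi> n x) \<in> test_functions \<Omega>" for n
      using \<phi>[of n] unfolding test_functions_iff by (auto intro!: Ck_cmult)
    have "grad (\<lambda>x. \<sigma> * \<phi> n x) x = \<sigma> *\<^sub>R grad (\<phi> n) x" for n x
      using GDERIV_mult[OF GDERIV_const GDERIV_test_function[OF \<phi>]] by (intro GDERIV_frechet(3)) auto
    then have "(\<sigma> * \<phi> n x - \<sigma> * v x)\<^sup>2 = (\<phi> n x - v x)\<^sup>2"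
        "(norm (grad (\<lambda>x. \<sigma> * \<phi> n x) x - \<sigma> *\<^sub>R g x))\<^sup>2 = (norm (grad (\<phi> n) x - g x))\<^sup>2" for n x
      by (simp_all add: \<sigma>2 power_mult_distrib flip: right_diff_distrib scaleR_diff_right)
    then show "(\<lambda>n. (\<integral>x. (\<sigma> * \<phi> n x - \<sigma> * v x)\<^sup>2 \<partial>?M)
        + (\<integral>x. (norm (grad (\<lambda>x. \<sigma> * \<phi> n x) x - \<sigma> *\<^sub>R g x))\<^sup>2 \<partial>?M)) \<longlonglongrightarrow> 0"
      using conv by simp
    show "Ck k \<psi>" for k
      by (rule Ck\<psi>)
    show "0 \<le> \<psi> x" if "x \<in> \<Omega>" for x
      by (rule \<psi>(1)[OF that])
    fix \<eta> assume \<eta>: "\<eta> \<in> test_functions \<Omega>" and nonneg: "\<And>x. 0 \<le> \<eta> x"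
    have sq': "square_integrable \<Omega> (grad \<eta>)" "square_integrable \<Omega> (grad \<psi>)"
      by (intro square_integrable_continuous continuous_on_test_function[OF \<eta>] continuous_on_grad Ck\<psi> \<Omega>)+
    have "(\<integral>x. (\<sigma> *\<^sub>R g x - grad \<psi> x) \<bullet> grad \<eta> x \<partial>?M)
        = \<sigma> * (\<integral>x. g x \<bullet> grad \<eta> x \<partial>?M) - (\<integral>x. grad \<psi> x \<bullet> grad \<eta> x \<partial>?M)"
      using square_integrable_inner[OF sq(2) sq'(1)] square_integrable_inner[OF sq'(2,1)]
      by (simp add: inner_diff_left)
    also have "\<dots> = (\<sigma> - 1) * (\<integral>x. \<eta> x \<partial>?M)"
      by (simp add: eq[OF \<eta>] \<psi>_eq[OF \<eta>] algebra_simps)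
    also have "\<dots> \<le> 0"
      using \<sigma> nonneg by (auto intro!: mult_nonpos_nonneg)
    finally show "(\<integral>x. (\<sigma> *\<^sub>R g x - grad \<psi> x) \<bullet> grad \<eta> x \<partial>?M) \<le> 0" .
  qed
  have "AE x in ?M. 1 * v x \<le> \<psi> x" "AE x in ?M. -1 * v x \<le> \<psi> x"
    by (intro main; simp)+
  moreover have "AE x in ?M. x \<in> \<Omega>"
    by (rule AE_I2) simp
  ultimately show ?thesis
  proof eventually_elim
    case (elim x)
    then show ?case
      using \<psi>(2)[of x] by (auto simp: abs_le_iff)
  qed
qed

section \<open>Upper bounds for the bottom of the spectrum\<close>

text \<open>A real \<open>Inf\<close> is controlled from below only over a nonempty set, so \<eta>
  serves both claims. Nonnegativity is wanted later, when the bound on the norm is multiplied by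
  \<open>dirichlet_bottom \<Omega>\<close>.\<close>

lemma dirichlet_bottom_le_Rayleigh:
  assumes \<Omega>: "open \<Omega>" "bounded \<Omega>" and \<eta>: "\<eta> \<in> test_functions \<Omega>"
    and pos: "0 < (\<integral>x. (\<eta> x)\<^sup>2 \<partial>lebesgue_on \<Omega>)"
  shows "0 \<le> dirichlet_bottom \<Omega>"
    and "dirichlet_bottom \<Omega>
      \<le> (\<integral>x. (norm (grad \<eta> x))\<^sup>2 \<partial>lebesgue_on \<Omega>) / (\<integral>x. (\<eta> x)\<^sup>2 \<partial>lebesgue_on \<Omega>)"
proof -
  let ?M = "lebesgue_on \<Omega>"
  let ?Q = "{(\<integral>x. (norm (g x))\<^sup>2 \<partial>?M) / (\<integral>x. (\<phi> x)\<^sup>2 \<partial>?M) | \<phi> g.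
    H01_grad \<Omega> \<phi> g \<and> \<not> (AE x in ?M. \<phi> x = 0)}"
  have "\<not> (AE x in ?M. \<eta> x = 0)"
  proof
    assume "AE x in ?M. \<eta> x = 0"
    then have "(\<integral>x. (\<eta> x)\<^sup>2 \<partial>?M) = 0"
      by (intro integral_eq_zero_AE) auto
    with pos show False
      by simp
  qed
  then have mem: "(\<integral>x. (norm (grad \<eta> x))\<^sup>2 \<partial>?M) / (\<integral>x. (\<eta> x)\<^sup>2 \<partial>?M) \<in> ?Q"
    using H01_grad_test_function[OF \<Omega> \<eta>] by blast
  have nonneg: "0 \<le> q" if "q \<in> ?Q" for q
    using that by (auto intro!: divide_nonneg_nonneg)
  show "0 \<le> dirichlet_bottom \<Omega>"
    unfolding dirichlet_bottom_def using mem nonneg by (intro cInf_greatest) auto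
  show "dirichlet_bottom \<Omega> \<le> (\<integral>x. (norm (grad \<eta> x))\<^sup>2 \<partial>?M) / (\<integral>x. (\<eta> x)\<^sup>2 \<partial>?M)"
    unfolding dirichlet_bottom_def using mem nonneg by (intro cInf_lower bdd_belowI[of _ 0]) auto
qed

text \<open>
  With the first eigenfunction \<open>S\<close> of the rectangle, which extends to a smooth function on the
  whole space, and \<open>\<eta> = soft_pos (N S - 1)\<close> we have
  \<open>\<integral>\<bar>grad \<eta>\<bar>\<^sup>2 \<le> \<integral>grad \<eta> \<bullet> grad (N S) = \<mu> \<integral>\<eta> N S\<close> and \<open>\<eta> N S \<le> \<eta>\<^sup>2 + 2 \<eta>\<close>, where the
  last term becomes negligible as \<open>N\<close> grows.  In dimension above 2 the hypothesis \<open>R\<close> cannot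
  hold, because the set on its left is then unbounded.
\<close>

lemma dirichlet_bottom_le_rectangle:
  fixes \<Omega> :: "'a::euclidean_space set" and e u p :: 'a
  assumes \<Omega>: "open \<Omega>" "bounded \<Omega>"
    and eu: "norm e = 1" "norm u = 1" "e \<bullet> u = 0" and AB: "0 < A" "0 < B"
    and R: "{x. 0 \<le> e \<bullet> (x - p) \<and> e \<bullet> (x - p) \<le> A \<and> 0 \<le> u \<bullet> (x - p) \<and> u \<bullet> (x - p) \<le> B} \<subseteq> \<Omega>"
  shows "0 \<le> dirichlet_bottom \<Omega>" "dirichlet_bottom \<Omega> \<le> (pi / A)\<^sup>2 + (pi / B)\<^sup>2"
proof -
  let ?M = "lebesgue_on \<Omega>"
  define Rc where "Rc = {x. 0 \<le> e \<bullet> (x - p) \<and> e \<bullet> (x - p) \<le> A \<and> 0 \<le> u \<bullet> (x - p) \<and> u \<bullet> (x - p) \<le> B}"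
  define Ro where "Ro = {x. 0 < e \<bullet> (x - p) \<and> e \<bullet> (x - p) < A \<and> 0 < u \<bullet> (x - p) \<and> u \<bullet> (x - p) < B}"
  define \<alpha> \<beta> \<mu> where "\<alpha> = pi / A" and "\<beta> = pi / B" and "\<mu> = \<alpha>\<^sup>2 + \<beta>\<^sup>2"
  define X Y where "X x = \<alpha> * (e \<bullet> x - e \<bullet> p)" and "Y x = \<beta> * (u \<bullet> x - u \<bullet> p)" for x
  define S where "S x = sin (X x) * sin (Y x)" for x
  define G where "G x = (\<alpha> * (cos (X x) * sin (Y x))) *\<^sub>R e + (\<beta> * (sin (X x) * cos (Y x))) *\<^sub>R u" for x
  define G' where "G' x h =
      (- (\<alpha>\<^sup>2 * S x) * (e \<bullet> h) + (\<alpha> * \<beta> * (cos (X x) * cos (Y x))) * (u \<bullet> h)) *\<^sub>R e +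
      ((\<alpha> * \<beta> * (cos (X x) * cos (Y x))) * (e \<bullet> h) + - (\<beta>\<^sup>2 * S x) * (u \<bullet> h)) *\<^sub>R u" for x h
  have RcRo: "Ro \<subseteq> Rc" "Rc \<subseteq> \<Omega>"
    using R by (auto simp: Ro_def Rc_def)
  have "closed Rc"
    unfolding Rc_def by (intro closed_Collect_conj closed_Collect_le continuous_intros)
  have "open Ro"
    unfolding Ro_def by (intro open_Collect_conj open_Collect_less continuous_intros)
  have CkS: "Ck k S" for k
    unfolding S_def[abs_def] X_def Y_def
    by (intro Ck_mult Ck_compose[OF Ck_sin_cos[THEN conjunct1]] Ck_cmult Ck_diff Ck_inner Ck_const)
  note contS = Ck_imp_continuous[OF CkS]
  have dXY: "(X has_derivative (\<lambda>h. \<alpha> * (e \<bullet> h))) (at x)" "(Y has_derivative (\<lambda>h. \<beta> * (u \<bullet> h))) (at x)" for x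
    unfolding X_def Y_def by (auto intro!: derivative_eq_intros)
  have contXY: "continuous_on UNIV X" "continuous_on UNIV Y"
    unfolding X_def Y_def by (intro continuous_intros)+
  have GS: "GDERIV S x :> G x" for x
    unfolding gderiv_def S_def
    by (rule has_derivative_eq_rhs, (rule derivative_eq_intros dXY refl)+)
      (simp add: G_def inner_add_right inner_commute algebra_simps fun_eq_iff)
  have GG': "(G has_derivative G' x) (at x)" for x
    unfolding G_def[abs_def]
    by (rule has_derivative_eq_rhs, (rule derivative_eq_intros dXY refl)+)
      (simp add: G'_def S_def algebra_simps power2_eq_square fun_eq_iff)
  have contG': "continuous_on UNIV (\<lambda>x. G' x b)" for b
    unfolding G'_def by (intro continuous_intros contXY contS)
  \<comment> \<open>\<open>G' x\<close> is the Hessian of \<open>S\<close> in the frame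
    \<open>e\<close>, \<open>u\<close>. Its mixed terms meet \<open>e \<bullet> u = 0\<close>, so
    the trace is the eigenvalue equation \<Delta>S = - \<mu> S.\<close>
  have trace: "(\<Sum>b\<in>Basis. G' x b \<bullet> b) = - (\<mu> * S x)" for x
  proof -
    have "(\<Sum>b\<in>Basis. ((c1 * (e \<bullet> b) + c2 * (u \<bullet> b)) *\<^sub>R e + (c2 * (e \<bullet> b) + c3 * (u \<bullet> b)) *\<^sub>R u) \<bullet> b)
        = c1 * (e \<bullet> e) + c2 * (e \<bullet> u) + c2 * (e \<bullet> u) + c3 * (u \<bullet> u)" for c1 c2 c3
      unfolding euclidean_inner[of e e] euclidean_inner[of e u] euclidean_inner[of u u]
      by (simp add: inner_add_left sum.distrib sum_distrib_left algebra_simps)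
    from this[of "- (\<alpha>\<^sup>2 * S x)" "\<alpha> * \<beta> * (cos (X x) * cos (Y x))" "- (\<beta>\<^sup>2 * S x)"] show ?thesis
      using eu by (simp add: G'_def \<mu>_def dot_square_norm algebra_simps)
  qed
  have S_boundary: "S x = 0" if "x \<in> Rc" "x \<notin> Ro" for x
  proof -
    have "e \<bullet> (x - p) = 0 \<or> e \<bullet> (x - p) = A \<or> u \<bullet> (x - p) = 0 \<or> u \<bullet> (x - p) = B"
      using that by (auto simp: Rc_def Ro_def)
    then have "X x = 0 \<or> X x = pi \<or> Y x = 0 \<or> Y x = pi"
      using AB by (auto simp: X_def Y_def \<alpha>_def \<beta>_def inner_diff_right)
    then show ?thesis
      by (auto simp: S_def)
  qed
  \<comment> \<open>A set of positive measure chosen before \<open>N\<close>: on it \<eta> becomes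
    large with \<open>N\<close>, which bounds the denominator of the Rayleigh quotient from
    below.\<close>
  define T where "T = {x \<in> Ro. 1 / 2 < S x}"
  have T: "open T" "T \<subseteq> Ro"
  proof -
    have "open {x. 1 / 2 < S x}"
      by (intro open_Collect_less continuous_intros contS)
    then have "open (Ro \<inter> {x. 1 / 2 < S x})"
      using \<open>open Ro\<close> by blast
    also have "Ro \<inter> {x. 1 / 2 < S x} = T"
      by (auto simp: T_def)
    finally show "open T" .
  qed (auto simp: T_def)
  define m where "m = measure ?M T"
  have finT: "emeasure ?M T < \<infinity>" and sT: "T \<in> sets ?M" and m: "0 < m"
  proof -
    \<comment> \<open>The centre of the rectangle, where \<open>S\<close> equals 1.\<close>
    let ?c = "p + (A / 2) *\<^sub>R e + (B / 2) *\<^sub>R u"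
    have ip: "e \<bullet> e = 1" "u \<bullet> u = 1" "u \<bullet> e = 0"
      using eu by (auto simp: dot_square_norm inner_commute)
    have "?c \<in> T"
      using AB eu(3) by (simp add: T_def Ro_def S_def X_def Y_def \<alpha>_def \<beta>_def inner_add_right inner_diff_right ip)
    then have "\<not> negligible T"
      using T(1) open_not_negligible by blast
    moreover have "T \<subseteq> \<Omega>"
      using T RcRo by blast
    moreover have lm: "T \<in> lmeasurable"
      using T(1) bounded_subset[OF \<Omega>(2) \<open>T \<subseteq> \<Omega>\<close>] lmeasurable_open by blast
    ultimately show "0 < m"
      using \<Omega>(1) by (simp add: m_def measure_restrict_space negligible_iff_measure zero_less_measure_iff)
    show "T \<in> sets ?M"
      using T(1) \<open>T \<subseteq> \<Omega>\<close> \<Omega>(1) by (simp add: sets_restrict_space_iff)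
    show "emeasure ?M T < \<infinity>"
      using lm \<open>T \<subseteq> \<Omega>\<close> \<Omega>(1) by (simp add: emeasure_restrict_space fmeasurable_def del: emeasure_completion)
  qed
  have main: "0 \<le> dirichlet_bottom \<Omega> \<and> dirichlet_bottom \<Omega> \<le> \<mu> * (1 + 2 * \<delta>)" if \<delta>: "0 < \<delta>" for \<delta>
  proof -
    define \<nu> where "\<nu> = (\<integral>x. (1::real) \<partial>?M)"
    have int_const: "integrable ?M (\<lambda>x. c)" for c :: real
      by (intro integrable_continuous_bounded continuous_intros \<Omega>)
    have \<nu>: "0 \<le> \<nu>"
      by (simp add: \<nu>_def)
    \<comment> \<open>The root makes
      \<open>\<nu> / \<delta> \<le> \<delta> * (k\<^sup>2 * m)\<close>, and the added 1 keeps
      \<open>k\<close> positive. With \<open>N = 2 * k + 4\<close>, on \<open>T\<close> we have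
      \<open>N * S x \<ge> k + 2\<close>; the shift by 1 and the loss in \<open>soft_pos_ge\<close>
      leave \<eta> at least \<open>k\<close>.\<close>
    define k where "k = sqrt (\<nu> / (\<delta>\<^sup>2 * m)) + 1"
    define N where "N = 2 * k + 4"
    have k: "1 \<le> k"
      using \<nu> m by (simp add: k_def)
    then have "0 < N"
      by (simp add: N_def)
    have "\<nu> / (\<delta>\<^sup>2 * m) \<le> k\<^sup>2"
      using \<nu> m power_mono[of "sqrt (\<nu> / (\<delta>\<^sup>2 * m))" k 2] by (simp add: k_def)
    then have km: "\<nu> / \<delta> \<le> \<delta> * (k\<^sup>2 * m)"
      using m \<delta> by (simp add: field_simps power2_eq_square)
    \<comment> \<open>\<open>S\<close> vanishes on the boundary of the rectangle, so this superlevel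
      set is a compact part of the open rectangle. That is why 1 is subtracted before
      truncating.\<close>
    define K where "K = Rc \<inter> {x. 1 \<le> N * S x}"
    have K: "compact K" "K \<subseteq> Ro"
    proof -
      have "closed {x. 1 \<le> N * S x}"
        by (intro closed_Collect_le continuous_intros contS)
      moreover have "bounded Rc"
        using \<Omega>(2) RcRo(2) bounded_subset by blast
      ultimately show "compact K"
        using \<open>closed Rc\<close> unfolding K_def by (intro compact_Int_closed) (simp_all add: compact_eq_bounded_closed)
      show "K \<subseteq> Ro"
        using S_boundary by (force simp: K_def)
    qed
    define \<eta> where "\<eta> x = (if x \<in> Ro then soft_pos (N * S x - 1) else 0)" for x
    have \<eta>_K: "\<eta> x = 0" if "x \<notin> K" for x
      using that RcRo(1) by (auto simp: \<eta>_def K_def soft_pos_eq_0_iff)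
    have "Ck k (\<lambda>x. soft_pos (N * S x - 1))" for k
      by (rule Ck_compose[OF Ck_soft_pos Ck_diff[OF Ck_cmult[OF CkS] Ck_const]])
    then have "\<eta> \<in> test_functions Ro"
      unfolding \<eta>_def[abs_def]
    proof (rule test_functions_cutoff[OF \<open>open Ro\<close> K])
      fix x assume "x \<in> Ro" "x \<notin> K"
      then show "soft_pos (N * S x - 1) = 0"
        using \<eta>_K[of x] by (simp add: \<eta>_def)
    qed
    then have \<eta>: "\<eta> \<in> test_functions \<Omega>"
      by (rule test_functions_mono) (use RcRo in blast)
    note cont = continuous_on_test_function[OF \<eta>]
    have grad_Ro: "grad \<eta> x = soft_pos' (N * S x - 1) *\<^sub>R N *\<^sub>R G x" if "x \<in> Ro" for x
    proof -
      have "GDERIV (\<lambda>x. N * S x - 1) x :> N *\<^sub>R G x"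
        using GDERIV_diff[OF GDERIV_mult[OF GDERIV_const[of N] GS] GDERIV_const[of 1], of x] by simp
      then show ?thesis
        unfolding \<eta>_def[abs_def]
        by (rule grad_cutoff[OF \<open>open Ro\<close> that GDERIV_DERIV_compose[OF _ DERIV_soft_pos]])
    qed
    have grad_K: "grad \<eta> x = 0" if "x \<notin> K" for x
    proof (rule GDERIV_frechet(3))
      have "(\<eta> has_derivative (\<lambda>_. 0)) (at x)"
        by (rule has_derivative_transform_within_open[of "\<lambda>_. 0" _ _ _ "- K"])
          (use that K(1) \<eta>_K compact_imp_closed in auto)
      then show "GDERIV \<eta> x :> 0"
        by (simp add: gderiv_def)
    qed
    define I where "I = (\<integral>x. (\<eta> x)\<^sup>2 \<partial>?M)"
    have contG: "continuous_on UNIV G"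
      by (intro continuous_at_imp_continuous_on ballI has_derivative_continuous[OF GG'])
    have i1: "integrable ?M (\<lambda>x. (norm (grad \<eta> x))\<^sup>2)" and i2: "integrable ?M (\<lambda>x. grad \<eta> x \<bullet> N *\<^sub>R G x)"
      and i3: "integrable ?M (\<lambda>x. \<eta> x * (N * S x))" and i4: "integrable ?M (\<lambda>x. (\<eta> x)\<^sup>2)"
      by (intro integrable_continuous_bounded continuous_intros cont contG contS \<Omega>)+
    have "(\<integral>x. (norm (grad \<eta> x))\<^sup>2 \<partial>?M) \<le> (\<integral>x. grad \<eta> x \<bullet> N *\<^sub>R G x \<partial>?M)"
    proof (rule integral_mono[OF i1 i2])
      fix x
      show "(norm (grad \<eta> x))\<^sup>2 \<le> grad \<eta> x \<bullet> N *\<^sub>R G x"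
      proof (cases "x \<in> K")
        case True
        define c where "c = soft_pos' (N * S x - 1)"
        have c: "0 \<le> c" "c \<le> 1"
          by (auto simp: c_def soft_pos'_bounds)
        let ?w = "N *\<^sub>R G x"
        have g: "grad \<eta> x = c *\<^sub>R ?w"
          using grad_Ro K(2) True by (auto simp: c_def)
        have "(norm (grad \<eta> x))\<^sup>2 = c * (c * (?w \<bullet> ?w))"
          unfolding g power2_norm_eq_inner by simp
        also have "\<dots> \<le> c * (?w \<bullet> ?w)"
          using c by (intro mult_left_mono mult_left_le_one_le inner_ge_zero)
        also have "\<dots> = grad \<eta> x \<bullet> ?w"
          unfolding g by simp
        finally show ?thesis .
      qed (simp add: grad_K)
    qed
    also have "\<dots> = - (\<integral>x. \<eta> x * (\<Sum>b\<in>Basis. (N *\<^sub>R G' x b) \<bullet> b) \<partial>?M)"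
      by (intro test_function_divergence \<Omega> \<eta> continuous_intros contG' has_derivative_scaleR_right GG')
    also have "\<dots> = \<mu> * (\<integral>x. \<eta> x * (N * S x) \<partial>?M)"
      by (simp add: trace algebra_simps flip: sum_distrib_left Bochner_Integration.integral_minus integral_mult_right_zero)
    also have "\<dots> \<le> \<mu> * (\<integral>x. (1 + \<delta>) * (\<eta> x)\<^sup>2 + 1 / \<delta> \<partial>?M)"
    proof (intro mult_left_mono integral_mono Bochner_Integration.integrable_add integrable_mult_right i3 i4 int_const)
      fix x
      have "\<eta> x * (N * S x) \<le> \<eta> x * (\<eta> x + 2)"
        using soft_pos_ge[of "N * S x - 1"] by (auto simp: \<eta>_def intro!: mult_left_mono soft_pos_nonneg)
      \<comment> \<open>The linear term is split by \<open>2 * \<eta> x \<le> \<delta> * (\<eta>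
        x)\<^sup>2 + 1 / \<delta>\<close>; the constant integrates to
        \<open>\<nu> / \<delta>\<close>, which the choice of \<open>k\<close> bounds by
        \<open>\<delta> * I\<close>.\<close>
      also have "\<dots> \<le> (1 + \<delta>) * (\<eta> x)\<^sup>2 + 1 / \<delta>"
        using \<delta> zero_le_power2[of "\<delta> * \<eta> x - 1"] by (simp add: field_simps power2_eq_square)
      finally show "\<eta> x * (N * S x) \<le> (1 + \<delta>) * (\<eta> x)\<^sup>2 + 1 / \<delta>" .
    qed (simp add: \<mu>_def)
    also have "(\<integral>x. (1 + \<delta>) * (\<eta> x)\<^sup>2 + 1 / \<delta> \<partial>?M) = (1 + \<delta>) * I + \<nu> / \<delta>"
      using i4 int_const[of "1 / \<delta>"] by (simp add: I_def \<nu>_def)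
    finally have top: "(\<integral>x. (norm (grad \<eta> x))\<^sup>2 \<partial>?M) \<le> \<mu> * ((1 + \<delta>) * I + \<nu> / \<delta>)" .
    have "k\<^sup>2 * m = (\<integral>x. k\<^sup>2 * indicator T x \<partial>?M)"
      using sets.Int_space_eq2[OF sT] by (simp add: m_def)
    also have "\<dots> \<le> I"
      unfolding I_def
    proof (rule integral_mono[OF _ i4])
      show "integrable ?M (\<lambda>x. k\<^sup>2 * indicator T x)"
        using finT sT by (intro integrable_mult_right integrable_real_indicator)
      fix x
      show "k\<^sup>2 * indicator T x \<le> (\<eta> x)\<^sup>2"
      proof (cases "x \<in> T")
        case True
        then have "x \<in> Ro" "1 / 2 < S x"
          by (auto simp: T_def)
        then have "N / 2 \<le> N * S x"
          using \<open>0 < N\<close> by simp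
        then have "k \<le> \<eta> x"
          using soft_pos_ge[of "N * S x - 1"] \<open>x \<in> Ro\<close> by (simp add: \<eta>_def N_def)
        with k True show ?thesis
          by (simp add: power_mono)
      qed simp
    qed
    finally have Ik: "k\<^sup>2 * m \<le> I" .
    have "0 < k\<^sup>2 * m"
      using k m by simp
    with Ik have I: "0 < I"
      by simp
    have "\<nu> / \<delta> \<le> \<delta> * I"
      using km mult_left_mono[OF Ik less_imp_le[OF \<delta>]] by (rule order_trans)
    then have "\<mu> * ((1 + \<delta>) * I + \<nu> / \<delta>) \<le> \<mu> * ((1 + \<delta>) * I + \<delta> * I)"
      by (intro mult_left_mono add_left_mono) (simp_all add: \<mu>_def)
    with top have "(\<integral>x. (norm (grad \<eta> x))\<^sup>2 \<partial>?M) \<le> \<mu> * (1 + 2 * \<delta>) * I"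
      by (simp add: algebra_simps)
    then have "(\<integral>x. (norm (grad \<eta> x))\<^sup>2 \<partial>?M) / I \<le> \<mu> * (1 + 2 * \<delta>)"
      using I by (simp add: pos_divide_le_eq)
    with dirichlet_bottom_le_Rayleigh[OF \<Omega> \<eta>] I show ?thesis
      unfolding I_def by auto
  qed
  then show "0 \<le> dirichlet_bottom \<Omega>"
    using zero_less_one by blast
  have "((\<lambda>\<delta>. \<mu> * (1 + 2 * \<delta>)) \<longlongrightarrow> \<mu> * (1 + 2 * 0)) (at_right 0)"
    by (intro tendsto_intros)
  moreover have "\<forall>\<^sub>F \<delta> in at_right 0. dirichlet_bottom \<Omega> \<le> \<mu> * (1 + 2 * \<delta>)"
    using main by (intro eventually_at_rightI[of 0 1]) auto
  ultimately have "dirichlet_bottom \<Omega> \<le> \<mu> * (1 + 2 * 0)"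
    by (rule tendsto_lowerbound) simp
  then show "dirichlet_bottom \<Omega> \<le> (pi / A)\<^sup>2 + (pi / B)\<^sup>2"
    by (simp add: \<mu>_def \<alpha>_def \<beta>_def)
qed

section \<open>Width and inscribed rectangles\<close>

lemma setdist_hyperplanes:
  fixes e :: "'a::euclidean_space"
  assumes "norm e = 1"
  shows "setdist {x. e \<bullet> x = a} {x. e \<bullet> x = b} = \<bar>b - a\<bar>"
proof (rule antisym)
  have ee: "e \<bullet> e = 1"
    using assms by (simp add: dot_square_norm)
  have mem: "a *\<^sub>R e \<in> {x. e \<bullet> x = a}" "b *\<^sub>R e \<in> {x. e \<bullet> x = b}"
    by (auto simp: ee)
  have "setdist {x. e \<bullet> x = a} {x. e \<bullet> x = b} \<le> dist (a *\<^sub>R e) (b *\<^sub>R e)"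
    by (rule setdist_le_dist) (use mem in auto)
  also have "\<dots> = \<bar>b - a\<bar>"
    using assms by (simp add: dist_norm abs_minus_commute flip: scaleR_diff_left)
  finally show "setdist {x. e \<bullet> x = a} {x. e \<bullet> x = b} \<le> \<bar>b - a\<bar>" .
  show "\<bar>b - a\<bar> \<le> setdist {x. e \<bullet> x = a} {x. e \<bullet> x = b}"
  proof (rule le_setdistI)
    fix x y assume "x \<in> {x. e \<bullet> x = a}" "y \<in> {x. e \<bullet> x = b}"
    then have "\<bar>b - a\<bar> = \<bar>e \<bullet> (y - x)\<bar>"
      by (simp add: inner_diff_right)
    also have "\<dots> \<le> dist x y"
      using Cauchy_Schwarz_ineq2[of e "y - x"] assms by (simp add: dist_norm norm_minus_commute)
    finally show "\<bar>b - a\<bar> \<le> dist x y" .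
  qed (use mem in blast)+
qed

lemma supporting_strip:
  fixes \<Omega> :: "'a::euclidean_space set"
  assumes "\<Omega> \<noteq> {}" "bounded \<Omega>"
  obtains y z where "y \<in> closure \<Omega>" "z \<in> closure \<Omega>" "\<forall>x\<in>\<Omega>. e \<bullet> y \<le> e \<bullet> x \<and> e \<bullet> x \<le> e \<bullet> z"
proof -
  have cl: "compact (closure \<Omega>)" "closure \<Omega> \<noteq> {}" "continuous_on (closure \<Omega>) (\<lambda>x. e \<bullet> x)"
    using assms by (auto intro!: continuous_intros)
  obtain y where "y \<in> closure \<Omega>" "\<forall>x\<in>closure \<Omega>. e \<bullet> y \<le> e \<bullet> x"
    using continuous_attains_inf[OF cl] by blast
  moreover obtain z where "z \<in> closure \<Omega>" "\<forall>x\<in>closure \<Omega>. e \<bullet> x \<le> e \<bullet> z"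
    using continuous_attains_sup[OF cl] by blast
  ultimately show thesis
    using that closure_subset by (metis (no_types, lifting) subsetD)
qed

lemma width_le_strip:
  assumes \<Omega>: "\<Omega> \<noteq> {}" "bounded \<Omega>" and e: "norm e = 1"
    and ab: "\<And>x. x \<in> \<Omega> \<Longrightarrow> a \<le> e \<bullet> x \<and> e \<bullet> x \<le> b"
  shows "width \<Omega> \<le> b - a"
proof -
  obtain y z where yz: "y \<in> closure \<Omega>" "z \<in> closure \<Omega>" "\<forall>x\<in>\<Omega>. e \<bullet> y \<le> e \<bullet> x \<and> e \<bullet> x \<le> e \<bullet> z"
    using supporting_strip[OF \<Omega>] .
  have "closure \<Omega> \<subseteq> {x. a \<le> e \<bullet> x} \<inter> {x. e \<bullet> x \<le> b}"
    using ab by (intro closure_minimal closed_Int closed_Collect_le continuous_intros) auto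
  then have *: "a \<le> e \<bullet> y" "e \<bullet> z \<le> b"
    using yz by auto
  obtain x where "x \<in> \<Omega>"
    using \<Omega> by blast
  then have "e \<bullet> y \<le> e \<bullet> z"
    using yz(3) by force
  have "width \<Omega> \<le> setdist {x. e \<bullet> x = e \<bullet> y} {x. e \<bullet> x = e \<bullet> z}"
    unfolding width_def
  proof (rule cInf_lower)
    show "bdd_below {setdist {x. e \<bullet> x = a} {x. e \<bullet> x = b} | e a b.
        norm e = 1 \<and> (\<forall>x\<in>\<Omega>. a \<le> e \<bullet> x \<and> e \<bullet> x \<le> b) \<and>
        {x. e \<bullet> x = a} \<inter> closure \<Omega> \<noteq> {} \<and> {x. e \<bullet> x = b} \<inter> closure \<Omega> \<noteq> {}}"
      by (rule bdd_belowI[of _ 0]) auto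
  qed (use yz e in blast)
  also have "\<dots> = e \<bullet> z - e \<bullet> y"
    using \<open>e \<bullet> y \<le> e \<bullet> z\<close> by (simp add: setdist_hyperplanes[OF e])
  finally show ?thesis
    using * by simp
qed

lemma exists_unit_vector: "\<exists>e::'a::euclidean_space. norm e = 1"
  using nonempty_Basis norm_Basis by blast

text \<open>Strips close to the infimum suffice, since the excess is removed by a limit; this avoids
  showing that the infimum is attained.\<close>

lemma strip_near_width:
  assumes \<Omega>: "\<Omega> \<noteq> {}" "bounded \<Omega>" and "width \<Omega> < c"
  obtains e a b where "norm e = 1" "\<forall>x\<in>\<Omega>. a \<le> e \<bullet> x \<and> e \<bullet> x \<le> b" "a \<le> b" "b - a < c"
proof -
  let ?W = "{setdist {x. e \<bullet> x = a} {x. e \<bullet> x = b} | e a b.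
        norm e = 1 \<and> (\<forall>x\<in>\<Omega>. a \<le> e \<bullet> x \<and> e \<bullet> x \<le> b) \<and>
        {x. e \<bullet> x = a} \<inter> closure \<Omega> \<noteq> {} \<and> {x. e \<bullet> x = b} \<inter> closure \<Omega> \<noteq> {}}"
  obtain e0 :: "real^2" where e0: "norm e0 = 1"
    using exists_unit_vector by blast
  obtain y z where "y \<in> closure \<Omega>" "z \<in> closure \<Omega>" "\<forall>x\<in>\<Omega>. e0 \<bullet> y \<le> e0 \<bullet> x \<and> e0 \<bullet> x \<le> e0 \<bullet> z"
    using supporting_strip[OF \<Omega>] .
  then have "?W \<noteq> {}"
    using e0 by blast
  then obtain w where "w \<in> ?W" "w < c"
    using cInf_lessD[of ?W c] assms(3) unfolding width_def by blast
  then obtain e a b where eab: "norm e = 1" "\<forall>x\<in>\<Omega>. a \<le> e \<bullet> x \<and> e \<bullet> x \<le> b"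
    "setdist {x. e \<bullet> x = a} {x. e \<bullet> x = b} < c"
    by blast
  moreover obtain x where "x \<in> \<Omega>"
    using \<Omega> by blast
  ultimately show thesis
    using that[of e a b] setdist_hyperplanes[OF eab(1), of a b] by force
qed

lemma width_pos:
  assumes \<Omega>: "\<Omega> \<noteq> {}" "bounded \<Omega>" "open \<Omega>"
  shows "0 < width \<Omega>"
proof -
  obtain c r where r: "0 < r" "cball c r \<subseteq> \<Omega>"
    using \<Omega> open_contains_cball by blast
  have "r \<le> width \<Omega>"
  proof (rule ccontr)
    assume "\<not> r \<le> width \<Omega>"
    then obtain e a b where e: "norm e = 1" "\<forall>x\<in>\<Omega>. a \<le> e \<bullet> x \<and> e \<bullet> x \<le> b" "b - a < r"
      using strip_near_width[OF \<Omega>(1,2), of r] by (metis not_le)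
    have "c \<in> \<Omega>" "c + r *\<^sub>R e \<in> \<Omega>"
      using r e(1) by (auto simp: dist_norm intro!: subsetD[OF r(2)])
    then have "a \<le> e \<bullet> c" "e \<bullet> (c + r *\<^sub>R e) \<le> b"
      using e(2) by auto
    with e(1,3) show False
      by (simp add: inner_add_right dot_square_norm)
  qed
  with r show ?thesis
    by simp
qed

lemma width_le_diameter:
  assumes \<Omega>: "\<Omega> \<noteq> {}" "bounded \<Omega>"
  shows "width \<Omega> \<le> diameter \<Omega>"
proof -
  obtain e :: "real^2" where e: "norm e = 1"
    using exists_unit_vector by blast
  obtain y z where yz: "y \<in> closure \<Omega>" "z \<in> closure \<Omega>" "\<forall>x\<in>\<Omega>. e \<bullet> y \<le> e \<bullet> x \<and> e \<bullet> x \<le> e \<bullet> z"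
    using supporting_strip[OF \<Omega>] .
  have "width \<Omega> \<le> e \<bullet> z - e \<bullet> y"
    using width_le_strip[OF \<Omega> e] yz(3) by blast
  also have "\<dots> \<le> norm (z - y)"
    using norm_cauchy_schwarz[of e "z - y"] e by (simp add: inner_diff_right)
  also have "\<dots> \<le> diameter (closure \<Omega>)"
    using diameter_bounded_bound[OF bounded_closure[OF \<Omega>(2)] yz(2,1)] by (simp add: dist_norm)
  finally show ?thesis
    using diameter_closure[OF \<Omega>(2)] by simp
qed

text \<open>If there is no such chord then a line separates \<open>\<Omega>\<close> from its translate by \<open>t u\<close>,
  which puts \<open>\<Omega>\<close> into a strip of width at most \<open>t\<close>.\<close>

lemma chord_of_length_less_width:
  assumes \<Omega>: "\<Omega> \<noteq> {}" "bounded \<Omega>" "convex \<Omega>" and u: "norm u = 1" and t: "0 \<le> t" "t < width \<Omega>"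
  obtains x where "x \<in> \<Omega>" "x + t *\<^sub>R u \<in> \<Omega>"
proof (rule ccontr)
  assume "\<not> thesis"
  then have no: "x + t *\<^sub>R u \<notin> \<Omega>" if "x \<in> \<Omega>" for x
    using that \<open>\<And>x. x \<in> \<Omega> \<Longrightarrow> x + t *\<^sub>R u \<in> \<Omega> \<Longrightarrow> thesis\<close> by blast
  have "\<exists>n c. n \<noteq> 0 \<and> (\<forall>x\<in>\<Omega>. n \<bullet> x \<le> c) \<and> (\<forall>x\<in>(\<lambda>x. t *\<^sub>R u + x) ` \<Omega>. n \<bullet> x \<ge> c)"
    by (rule separating_hyperplane_sets[OF \<Omega>(3) convex_translation[OF \<Omega>(3)]])
      (use \<Omega> no in \<open>auto simp: add.commute\<close>)
  then obtain n c where n: "n \<noteq> 0" "\<And>x. x \<in> \<Omega> \<Longrightarrow> n \<bullet> x \<le> c" "\<And>x. x \<in> \<Omega> \<Longrightarrow> c \<le> n \<bullet> (t *\<^sub>R u + x)"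
    by auto
  define e where "e = n /\<^sub>R norm n"
  have e: "norm e = 1"
    using n(1) by (simp add: e_def)
  have "c / norm n - t * (e \<bullet> u) \<le> e \<bullet> x \<and> e \<bullet> x \<le> c / norm n" if "x \<in> \<Omega>" for x
    using divide_right_mono[OF n(2)[OF that] norm_ge_zero[of n]] divide_right_mono[OF n(3)[OF that] norm_ge_zero[of n]]
    by (simp add: e_def inner_add_right divide_inverse algebra_simps)
  from width_le_strip[OF \<Omega>(1,2) e this]
  have "width \<Omega> \<le> t * (e \<bullet> u)"
    by simp
  also have "\<dots> \<le> t * 1"
    using t norm_cauchy_schwarz[of e u] e u by (intro mult_left_mono) auto
  finally show False
    using t by simp
qed

text \<open>Since \<Omega> is open, the ends of a diameter lie only in its closure, and chords are
  available only for lengths below the width. The first defect is harmless because a positive share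
  \<open>1 - s\<close> of each point comes from \<Omega>; the second is removed by letting
  \<open>t\<close> tend to the width.\<close>

lemma dirichlet_bottom_le_width_diameter:
  fixes \<Omega> :: "(real^2) set"
  assumes \<Omega>: "\<Omega> \<noteq> {}" "bounded \<Omega>" "open \<Omega>" "convex \<Omega>" and s: "0 < s" "s < 1"
  shows "0 \<le> dirichlet_bottom \<Omega>"
    and "dirichlet_bottom \<Omega> \<le> (pi / (s * diameter \<Omega>))\<^sup>2 + (pi / ((1 - s) * width \<Omega>))\<^sup>2"
proof -
  define d where "d = diameter \<Omega>"
  have w: "0 < width \<Omega>"
    by (rule width_pos[OF \<Omega>(1-3)])
  then have d: "0 < d"
    using width_le_diameter[OF \<Omega>(1,2)] by (simp add: d_def)
  obtain P Q where PQ: "P \<in> closure \<Omega>" "Q \<in> closure \<Omega>" "dist P Q = d"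
    using diameter_compact_attained[of "closure \<Omega>"] \<Omega> diameter_closure[OF \<Omega>(2)] by (auto simp: d_def)
  define e where "e = (Q - P) /\<^sub>R d"
  have e: "norm e = 1" and Q: "Q - P = d *\<^sub>R e"
    using d PQ(3) by (auto simp: e_def dist_norm norm_minus_commute)
  \<comment> \<open>\<open>e\<close> turned by a right angle, so that \<open>e\<close>,
    \<open>u\<close> is an orthonormal frame and the combination of chord and diameter is a
    rectangle.\<close>
  define u :: "real^2" where "u = vector [- (e $ 2), e $ 1]"
  have e2: "(e $ 1)\<^sup>2 + (e $ 2)\<^sup>2 = 1"
    using e by (simp add: norm_eq_1 inner_vec_def sum_2 power2_eq_square)
  have u: "norm u = 1"
    using e2 by (simp add: norm_eq_1 inner_vec_def sum_2 power2_eq_square u_def vector_2 add.commute)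
  have eu: "e \<bullet> u = 0"
    by (simp add: inner_vec_def sum_2 u_def vector_2)
  have expand: "z = (e \<bullet> z) *\<^sub>R e + (u \<bullet> z) *\<^sub>R u" for z
  proof -
    have "e \<bullet> z = e $ 1 * z $ 1 + e $ 2 * z $ 2" "u \<bullet> z = e $ 1 * z $ 2 - e $ 2 * z $ 1"
      by (simp_all add: inner_vec_def sum_2 u_def vector_2)
    moreover have "(a * x + b * y) * a - (a * y - b * x) * b = x * (a\<^sup>2 + b\<^sup>2)"
      "(a * x + b * y) * b + (a * y - b * x) * a = y * (a\<^sup>2 + b\<^sup>2)" for a b x y :: real
      by (simp_all add: algebra_simps power2_eq_square)
    ultimately show ?thesis
      by (simp add: vec_eq_iff forall_2 u_def vector_2 e2)
  qed
  have main: "0 \<le> dirichlet_bottom \<Omega> \<and> dirichlet_bottom \<Omega> \<le> (pi / (s * d))\<^sup>2 + (pi / ((1 - s) * t))\<^sup>2"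
    if t: "0 < t" "t < width \<Omega>" for t
  proof -
    obtain x0 where x0: "x0 \<in> \<Omega>" "x0 + t *\<^sub>R u \<in> \<Omega>"
      using chord_of_length_less_width[OF \<Omega>(1,2,4) u less_imp_le[OF t(1)] t(2)] .
    define p where "p = (1 - s) *\<^sub>R x0 + s *\<^sub>R P"
    have AB: "0 < s * d" "0 < (1 - s) * t"
      using s d t by auto
    have "{x. 0 \<le> e \<bullet> (x - p) \<and> e \<bullet> (x - p) \<le> s * d \<and> 0 \<le> u \<bullet> (x - p) \<and> u \<bullet> (x - p) \<le> (1 - s) * t} \<subseteq> \<Omega>"
    proof clarify
      fix x assume x: "0 \<le> e \<bullet> (x - p)" "e \<bullet> (x - p) \<le> s * d" "0 \<le> u \<bullet> (x - p)" "u \<bullet> (x - p) \<le> (1 - s) * t"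
      define \<sigma> \<tau> where "\<sigma> = e \<bullet> (x - p) / (s * d)" and "\<tau> = u \<bullet> (x - p) / ((1 - s) * t)"
      have \<sigma>: "0 \<le> \<sigma>" "\<sigma> \<le> 1" and \<tau>: "0 \<le> \<tau>" "\<tau> \<le> 1"
        using x AB by (auto simp: \<sigma>_def \<tau>_def divide_le_eq_1)
      have st: "e \<bullet> (x - p) = \<sigma> * (s * d)" "u \<bullet> (x - p) = \<tau> * ((1 - s) * t)"
        using AB by (auto simp: \<sigma>_def \<tau>_def)
      define y where "y = (1 - \<tau>) *\<^sub>R x0 + \<tau> *\<^sub>R (x0 + t *\<^sub>R u)"
      define z where "z = (1 - \<sigma>) *\<^sub>R P + \<sigma> *\<^sub>R Q"
      have y: "y \<in> interior \<Omega>"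
        using convexD[OF \<Omega>(4) x0, of "1 - \<tau>" \<tau>] \<tau> \<Omega>(3) by (simp add: y_def interior_open)
      have z: "z \<in> closure \<Omega>"
        using convexD[OF convex_closure[OF \<Omega>(4)] PQ(1,2), of "1 - \<sigma>" \<sigma>] \<sigma> by (simp add: z_def)
      \<comment> \<open>The point is \<open>(1 - s) *\<^sub>R y + s *\<^sub>R z\<close>, with
        \<open>y\<close> on the chord and \<open>z\<close> on the diameter; a closure point moved a
        positive fraction towards an interior point of a convex set becomes interior.\<close>
      have "z - (1 - s) *\<^sub>R (z - y) \<in> interior \<Omega>"
        by (rule mem_interior_closure_convex_shrink[OF \<Omega>(4) y z]) (use s in auto)
      moreover have "z - (1 - s) *\<^sub>R (z - y) = x"
      proof -
        have z': "z = P + (\<sigma> * d) *\<^sub>R e"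
        proof -
          have "z = P + \<sigma> *\<^sub>R (Q - P)"
            by (simp add: z_def algebra_simps)
          then show ?thesis
            by (simp add: Q)
        qed
        have y': "y = x0 + (\<tau> * t) *\<^sub>R u"
          by (simp add: y_def algebra_simps)
        have "x = p + (\<sigma> * (s * d)) *\<^sub>R e + (\<tau> * ((1 - s) * t)) *\<^sub>R u"
          using expand[of "x - p"] unfolding st by (simp add: algebra_simps)
        then show ?thesis
          by (simp add: y' z' p_def algebra_simps)
      qed
      ultimately show "x \<in> \<Omega>"
        using interior_subset by blast
    qed
    from dirichlet_bottom_le_rectangle[OF \<Omega>(3,2) e u eu AB this] show ?thesis
      by blast
  qed
  from main[of "width \<Omega> / 2"] w show "0 \<le> dirichlet_bottom \<Omega>"
    by simp
  have "((\<lambda>t. (pi / (s * d))\<^sup>2 + (pi / ((1 - s) * t))\<^sup>2) \<longlongrightarrow> (pi / (s * d))\<^sup>2 + (pi / ((1 - s) * width \<Omega>))\<^sup>2)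
      (at_left (width \<Omega>))"
    using w s by (intro tendsto_intros) auto
  moreover have "\<forall>\<^sub>F t in at_left (width \<Omega>). dirichlet_bottom \<Omega> \<le> (pi / (s * d))\<^sup>2 + (pi / ((1 - s) * t))\<^sup>2"
    using main w by (intro eventually_at_leftI[of 0]) auto
  ultimately show "dirichlet_bottom \<Omega> \<le> (pi / (s * diameter \<Omega>))\<^sup>2 + (pi / ((1 - s) * width \<Omega>))\<^sup>2"
    unfolding d_def by (rule tendsto_lowerbound) simp
qed

section \<open>The sup-norm bound and the final estimate\<close>

lemma Linf_norm_torsion_le:
  fixes \<Omega> :: "(real^2) set"
  assumes \<Omega>: "\<Omega> \<noteq> {}" "bounded \<Omega>" "open \<Omega>" and v: "is_torsion_function \<Omega> v"
  shows "Linf_norm \<Omega> v \<le> ereal ((width \<Omega>)\<^sup>2 / 8)"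
proof -
  have le: "Linf_norm \<Omega> v \<le> ereal ((width \<Omega> + \<epsilon>)\<^sup>2 / 8)" if "0 < \<epsilon>" for \<epsilon>
  proof -
    have "width \<Omega> < width \<Omega> + \<epsilon>"
      using that by simp
    then obtain e a b where e: "norm e = 1" "\<forall>x\<in>\<Omega>. a \<le> e \<bullet> x \<and> e \<bullet> x \<le> b" "a \<le> b" "b - a < width \<Omega> + \<epsilon>"
      using strip_near_width[OF \<Omega>(1,2)] by blast
    have "(b - a)\<^sup>2 / 8 \<le> (width \<Omega> + \<epsilon>)\<^sup>2 / 8"
      using e by (intro divide_right_mono power_mono) auto
    moreover have "AE x in lebesgue_on \<Omega>. \<bar>v x\<bar> \<le> (b - a)\<^sup>2 / 8"
      using e by (intro torsion_function_le_strip[OF \<Omega>(3,2) v e(1)]) auto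
    moreover have "v \<in> borel_measurable (lebesgue_on \<Omega>)"
      using v by (auto simp: is_torsion_function_def H01_grad_def has_weak_grad_def square_integrable_def)
    ultimately show ?thesis
      unfolding Linf_norm_def by (intro esssup_I) (auto elim: eventually_mono)
  qed
  have "((\<lambda>\<epsilon>. ereal ((width \<Omega> + \<epsilon>)\<^sup>2 / 8)) \<longlongrightarrow> ereal ((width \<Omega> + 0)\<^sup>2 / 8)) (at_right 0)"
    by (intro tendsto_intros) auto
  moreover have "\<forall>\<^sub>F \<epsilon> in at_right 0. Linf_norm \<Omega> v \<le> ereal ((width \<Omega> + \<epsilon>)\<^sup>2 / 8)"
    using le by (intro eventually_at_rightI[of 0 1]) auto
  ultimately have "Linf_norm \<Omega> v \<le> ereal ((width \<Omega> + 0)\<^sup>2 / 8)"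
    by (rule tendsto_lowerbound) simp
  then show ?thesis
    by simp
qed

theorem theorem2:
  fixes \<Omega> :: "(real^2) set" and v :: "real^2 \<Rightarrow> real"
  assumes "\<Omega> \<noteq> {}" and "bounded \<Omega>" and "open \<Omega>" and "convex \<Omega>"
    and "is_torsion_function \<Omega> v"
  shows "Linf_norm \<Omega> v * ereal (dirichlet_bottom \<Omega>)
      \<le> ereal (pi\<^sup>2 / 8 * (1 + 7 * 3 powr (2/3) * (width \<Omega> / diameter \<Omega>) powr (2/3)))"
proof -
  define w d where "w = width \<Omega>" and "d = diameter \<Omega>"
  define q where "q = (w / d) powr (2 / 3)"
  have w: "0 < w" "w \<le> d"
    using width_pos[OF assms(1-3)] width_le_diameter[OF assms(1,2)] by (auto simp: w_def d_def)
  then have d: "0 < d"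
    by simp
  have q: "0 < q" "q \<le> 1"
    using w d by (auto simp: q_def intro!: powr_le1)
  have q3: "q ^ 3 = (w / d)\<^sup>2"
  proof -
    have "q ^ 3 = q powr 3"
      using q by (simp flip: powr_numeral)
    also have "\<dots> = (w / d) powr 2"
      by (simp add: q_def powr_powr)
    finally show ?thesis
      using w d by simp
  qed
  have s: "0 < q / 2" "q / 2 < 1"
    using q by auto
  note db = dirichlet_bottom_le_width_diameter[OF assms(1-4) s, folded w_def d_def]
  have "Linf_norm \<Omega> v * ereal (dirichlet_bottom \<Omega>) \<le> ereal (w\<^sup>2 / 8) * ereal (dirichlet_bottom \<Omega>)"
    unfolding w_def using db(1) by (intro ereal_mult_right_mono Linf_norm_torsion_le assms) simp
  also have "\<dots> \<le> ereal (w\<^sup>2 / 8 * ((pi / (q / 2 * d))\<^sup>2 + (pi / ((1 - q / 2) * w))\<^sup>2))"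
    using db(2) by (auto intro!: mult_left_mono)
  also have "w\<^sup>2 / 8 * ((pi / (q / 2 * d))\<^sup>2 + (pi / ((1 - q / 2) * w))\<^sup>2)
      = pi\<^sup>2 / 8 * (4 * ((w / d)\<^sup>2 / q\<^sup>2) + 1 / (1 - q / 2)\<^sup>2)"
    using w d q by (simp add: power_mult_distrib power_divide divide_simps) (simp add: algebra_simps)
  also have "(w / d)\<^sup>2 / q\<^sup>2 = q"
    unfolding q3[symmetric] using q by (simp add: power3_eq_cube power2_eq_square)
  also have "ereal (pi\<^sup>2 / 8 * (4 * q + 1 / (1 - q / 2)\<^sup>2)) \<le> ereal (pi\<^sup>2 / 8 * (1 + 7 * 3 powr (2/3) * q))"
  proof -
    \<comment> \<open>The convex function 1 / (1 - q / 2)^2 takes the values 1 and 4 at q = 0 and q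
      = 1, so on [0, 1] it lies below its chord 1 + 3 q; the factors q and 1 - q mark the two
      contact points. Added to 4 q this gives the 7.\<close>
    have "0 \<le> q * ((1 - q) * (2 - 3 / 4 * q))"
      using q by (intro mult_nonneg_nonneg) auto
    also have "q * ((1 - q) * (2 - 3 / 4 * q)) = (1 + 3 * q) * (1 - q / 2)\<^sup>2 - 1"
      by (simp add: field_simps power2_eq_square)
    finally have "1 / (1 - q / 2)\<^sup>2 \<le> 1 + 3 * q"
      using s by (simp add: pos_divide_le_eq)
    moreover have "7 * q * 1 \<le> 7 * q * 3 powr (2/3)"
      using q by (intro mult_left_mono ge_one_powr_ge_zero) auto
    ultimately have "4 * q + 1 / (1 - q / 2)\<^sup>2 \<le> 1 + 7 * 3 powr (2/3) * q"
      by (simp add: algebra_simps)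
    then show ?thesis
      by (simp add: mult_left_mono)
  qed
  finally show ?thesis
    by (simp add: q_def w_def d_def)
qed

end
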